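(* Let $k$ be a perfect field of characteristic $p>0$, $\bm{x}=(x_{i,j})$ an $m\times n$ matrix of indeterminates, $S=k[\bm{x}]$, $\mu=\min\{m,n\}$. Define $\Delta=\alpha_1\cdots\alpha_{\mu-1}\,\delta_1\cdots\delta_{|n-m|+1}\,\beta_{\mu-1}\cdots\beta_1\in S$, where $\alpha_i$ is the $i$-minor of $\bm{x}$ on rows $m-i+1,\dots,m$ and columns $1,\dots,i$; $\beta_i$ is the $i$-minor on rows $1,\dots,i$ and columns $n-i+1,\dots,n$; and the $\delta_j$ are the $\mu$-minors on $\mu$ consecutive columns (if $m\le n$: rows $1,\dots,m$, columns $j,\dots,j+m-1$) or on $\mu$ consecutive rows (if $m\ge n$: rows $i,\dots,i+n-1$, columns $1,\dots,n$), one for each of the $|n-m|+1$ possible positions. Let $\Phi:F_*S\to S$ be the Frobenius trace of $S$ and $\phi=\Phi\circ F_*(\Delta^{p-1}\cdot -)\in\operatorname{Hom}_S(F_*S,S)$. Then $\phi(F_*1)=1$, and for every $2\le t\le\mu$, letting $\bm{x}'$ be the submatrix of the first $t-1$ rows of $\bm{x}$, both $I_t(\bm{x})$ and $I_{t-1}(\bm{x}')$ are $\phi$-compatible, i.e. $\phi(F_*I_t(\bm{x}))\subseteq I_t(\bm{x})$ and $\phi(F_*I_{t-1}(\bm{x}'))\subseteq I_{t-1}(\bm{x}')$.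
   Context: $F_*S$ is $S$ viewed as an $S$-module via Frobenius. Since $k$ is perfect, $F_*S$ is a free $S$-module with basis $F_*\bm{x}^{\bm a}$, $0\le a_{ij}\le p-1$; the Frobenius trace $\Phi$ is the $S$-linear map sending $F_*\prod_{i,j}x_{i,j}^{p-1}$ to $1$ and all other basis monomials to $0$. $I_t(M)$ is the ideal of $t\times t$ minors of $M$. *)

theory Defs
  imports "HOL-Library.Poly_Mapping" "HOL-Combinatorics.Permutations" "HOL-Computational_Algebra.Primes"
begin

text \<open>Polynomials over 'k in the indeterminates x_(i,j), indexed by pairs of naturals
  (0-based: row i < m, column j < n).  A monomial is a finitely supported exponent map.\<close>

type_synonym 'k mpoly = "((nat \<times> nat) \<Rightarrow>\<^sub>0 nat) \<Rightarrow>\<^sub>0 'k"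

definition Var :: "nat \<Rightarrow> nat \<Rightarrow> 'k::comm_ring_1 mpoly" where
  "Var i j = Poly_Mapping.single (Poly_Mapping.single (i, j) 1) 1"

definition grid :: "nat \<Rightarrow> nat \<Rightarrow> (nat \<times> nat) set" where
  "grid m n = {(i, j). i < m \<and> j < n}"

definition polyS :: "nat \<Rightarrow> nat \<Rightarrow> 'k::comm_ring_1 mpoly set" where
  "polyS m n = {f :: 'k mpoly. \<forall>e. e \<in> Poly_Mapping.keys f \<longrightarrow> Poly_Mapping.keys e \<subseteq> grid m n}"

definition ideal_genS :: "nat \<Rightarrow> nat \<Rightarrow> 'k::comm_ring_1 mpoly set \<Rightarrow> 'k mpoly set" where
  "ideal_genS m n G = {(\<Sum>g\<in>A. c g * g) | c A. finite A \<and> A \<subseteq> G \<and> (\<forall>g\<in>A. c g \<in> polyS m n)}"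

definition minor :: "nat \<Rightarrow> (nat \<Rightarrow> nat) \<Rightarrow> (nat \<Rightarrow> nat) \<Rightarrow> 'k::comm_ring_1 mpoly" where
  "minor r R C = (\<Sum>\<pi> | \<pi> permutes {..<r}. of_int (sign \<pi>) * (\<Prod>i<r. Var (R i) (C (\<pi> i))))"

definition minors :: "nat \<Rightarrow> nat \<Rightarrow> nat \<Rightarrow> 'k::comm_ring_1 mpoly set" where
  "minors t a b = {minor t R C | R C. strict_mono_on {..<t} R \<and> strict_mono_on {..<t} C
      \<and> (\<forall>i<t. R i < a \<and> C i < b)}"

text \<open>I_t(x) for the m x n generic matrix x; I_{t-1}(x') is then
  ideal_genS m n (minors (t-1) (t-1) n), x' being the first t-1 rows.\<close>
definition detIdeal :: "nat \<Rightarrow> nat \<Rightarrow> nat \<Rightarrow> nat \<Rightarrow> 'k::comm_ring_1 mpoly set" where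
  "detIdeal m n t a = ideal_genS m n (minors t a n)"

definition alpha :: "nat \<Rightarrow> nat \<Rightarrow> 'k::comm_ring_1 mpoly" where
  "alpha m i = minor i (\<lambda>k. m - i + k) (\<lambda>k. k)"

definition beta :: "nat \<Rightarrow> nat \<Rightarrow> 'k::comm_ring_1 mpoly" where
  "beta n i = minor i (\<lambda>k. k) (\<lambda>k. n - i + k)"

text \<open>delta_(j+1), j = 0..|n-m|: maximal minor on consecutive columns j+1..j+m (if m \<le> n)
  or consecutive rows j+1..j+n (if m \<ge> n).\<close>
definition delta :: "nat \<Rightarrow> nat \<Rightarrow> nat \<Rightarrow> 'k::comm_ring_1 mpoly" where
  "delta m n j = (if m \<le> n then minor m (\<lambda>k. k) (\<lambda>k. j + k) else minor n (\<lambda>k. j + k) (\<lambda>k. k))"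

definition Delta :: "nat \<Rightarrow> nat \<Rightarrow> 'k::comm_ring_1 mpoly" where
  "Delta m n = (let \<mu> = min m n; d = max m n - min m n in
     (\<Prod>i\<in>{1..<\<mu>}. alpha m i) * (\<Prod>j\<in>{0..d}. delta m n j) * (\<Prod>i\<in>{1..<\<mu>}. beta n i))"

text \<open>The unique p-th root in a perfect field of characteristic p.\<close>
definition proot :: "nat \<Rightarrow> 'k::field \<Rightarrow> 'k" where
  "proot p c = (THE r. r ^ p = c)"

text \<open>Frobenius trace Phi of S: writing f = sum_a g_a^p x^a (0 \<le> a_ij \<le> p-1), Phi f = g_(p-1,...,p-1).
  Explicitly, monomial c x^e is sent to c^(1/p) x^((e-(p-1))/p) if every e_ij (i<m, j<n)
  is congruent to p-1 mod p, and to 0 otherwise.\<close>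
definition frob_trace :: "nat \<Rightarrow> nat \<Rightarrow> nat \<Rightarrow> 'k::field mpoly \<Rightarrow> 'k mpoly" where
  "frob_trace p m n f = (\<Sum>e\<in>Poly_Mapping.keys f.
     if (\<forall>ij\<in>grid m n. Poly_Mapping.lookup e ij mod p = p - 1) \<and> (\<forall>ij. ij \<notin> grid m n \<longrightarrow> Poly_Mapping.lookup e ij mod p = 0)
     then Poly_Mapping.single (Poly_Mapping.map (\<lambda>k. k div p) e) (proot p (Poly_Mapping.lookup f e))
     else 0)"

definition phi :: "nat \<Rightarrow> nat \<Rightarrow> nat \<Rightarrow> 'k::field mpoly \<Rightarrow> 'k mpoly" where
  "phi p m n f = frob_trace p m n (Delta m n ^ (p - 1) * f)"

end

theory Submission
  imports Defs "Jordan_Normal_Form.Char_Poly"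
begin

text \<open>
  For a prime ideal \<open>P\<close> of height \<open>h\<close>, locally generated by \<open>h\<close> elements, \<open>\<Delta> \<in> P\<^sup>(\<^sup>h\<^sup>)\<close> forces
  \<open>\<Delta>\<^sup>p\<^sup>-\<^sup>1 P \<subseteq> P\<^bsup>[p]\<^esup>\<close> by the pigeonhole principle, whence \<open>\<phi>(P) \<subseteq> P\<close>.  An \<open>s\<close>-minor vanishes to order
  \<open>s - t + 1\<close> along \<open>I\<^sub>t\<close>, and these orders add up to \<open>h\<close> over the factors of \<open>\<Delta>\<close>.
  The local computation is done after inverting the top left \<open>(t - 1)\<close>-minor, where \<open>I\<^sub>t\<close> is generated by the
  \<open>h\<close> entries of a Schur complement; it shows that \<open>\<phi>(f)\<close> vanishes at the generic matrix of rank below \<open>t\<close>, hence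
  at all of them.  To conclude \<open>\<phi>(f) \<in> I\<^sub>t\<close> one needs that \<open>I\<^sub>t\<close> is the full ideal of polynomials
  vanishing at the matrices of rank below \<open>t\<close> over an infinite field.  This is proved for a larger family of
  one-sided ladder rank conditions by induction, removing one corner variable \<open>z\<close> at a time: the polynomials
  free of \<open>z\<close> and the leading coefficients in \<open>z\<close> belong to the vanishing ideals of two smaller ladders.
  Finally, \<open>\<phi>(1) = 1\<close> because the leading monomial of \<open>\<Delta>\<close> is the product of all variables.
\<close>

subsection \<open>Evaluation of polynomials\<close>

abbreviation mkeys :: "('a \<Rightarrow>\<^sub>0 'b::zero) \<Rightarrow> 'a set" where "mkeys \<equiv> Poly_Mapping.keys"
abbreviation coef :: "('a \<Rightarrow>\<^sub>0 'b::zero) \<Rightarrow> 'a \<Rightarrow> 'b" where "coef \<equiv> Poly_Mapping.lookup"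
abbreviation mterm :: "((nat \<times> nat) \<Rightarrow>\<^sub>0 nat) \<Rightarrow> 'k \<Rightarrow> 'k::comm_ring_1 mpoly" where
  "mterm \<equiv> Poly_Mapping.single"

text \<open>Arbitrary variable sets are allowed because the ladder induction deletes a variable of
  the grid; \<open>V = UNIV\<close> gives the ring in all variables.\<close>

definition polyV :: "(nat \<times> nat) set \<Rightarrow> 'k::comm_ring_1 mpoly set" where
  "polyV V = {f. \<forall>e\<in>mkeys f. mkeys e \<subseteq> V}"

lemma polyS_eq_polyV: "polyS m n = polyV (grid m n)"
  by (auto simp: polyS_def polyV_def)

lemma polyV_mono: "V \<subseteq> W \<Longrightarrow> f \<in> polyV V \<Longrightarrow> f \<in> polyV W"
  by (auto simp: polyV_def)

lemma mpoly_sum_terms: "f = (\<Sum>e\<in>mkeys f. mterm e (coef f e))"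
  by (rule poly_mapping_eqI)
    (simp add: lookup_sum lookup_single when_def sum.delta in_keys_iff)

lemma polyV_induct [consumes 1, case_names zero monomial add]:
  assumes f: "f \<in> polyV V" and z: "P 0"
    and m: "\<And>e c. mkeys e \<subseteq> V \<Longrightarrow> P (mterm e c)"
    and a: "\<And>f g. P f \<Longrightarrow> P g \<Longrightarrow> P (f + g)"
  shows "P f"
proof -
  have "finite A \<Longrightarrow> A \<subseteq> mkeys f \<Longrightarrow> P (\<Sum>e\<in>A. mterm e (coef f e))" for A
  proof (induction A rule: finite_induct)
    case empty
    show ?case using z by simp
  next
    case (insert x A)
    then show ?case using f by (auto simp: polyV_def intro!: a m)
  qed
  then show ?thesis
    using mpoly_sum_terms[of f] by (metis finite_keys order_refl)
qed

lemma polyV_UNIV: "f \<in> polyV UNIV"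
  by (simp add: polyV_def)

lemma mpoly_induct [case_names zero monomial add]:
  assumes "P 0" "\<And>e c. P (mterm e c)" "\<And>f g. P f \<Longrightarrow> P g \<Longrightarrow> P (f + g)"
  shows "P f"
  using polyV_UNIV[of f] by (induction rule: polyV_induct) (use assms in auto)

lemma polyV_0: "0 \<in> polyV V" by (simp add: polyV_def)

lemma polyV_single: "mkeys e \<subseteq> V \<Longrightarrow> mterm e c \<in> polyV V"
  by (simp add: polyV_def)

lemma polyV_1: "1 \<in> polyV V"
  using polyV_single[of 0 V 1] by simp

lemma polyV_add: "f \<in> polyV V \<Longrightarrow> g \<in> polyV V \<Longrightarrow> f + g \<in> polyV V"
  using keys_add[of f g] by (auto simp: polyV_def)

lemma polyV_uminus: "f \<in> polyV V \<Longrightarrow> - f \<in> polyV V"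
  by (auto simp: polyV_def in_keys_iff)

lemma polyV_mult: "f \<in> polyV V \<Longrightarrow> g \<in> polyV V \<Longrightarrow> f * g \<in> polyV V"
proof -
  assume f: "f \<in> polyV V" and g: "g \<in> polyV V"
  {
    fix e assume "e \<in> mkeys (f * g)"
    then obtain a b where "a \<in> mkeys f" "b \<in> mkeys g" "e = a + b"
      using keys_mult[of f g] by auto
    then have "mkeys e \<subseteq> V"
      using f g keys_add[of a b] unfolding polyV_def by blast
  }
  then show ?thesis by (auto simp: polyV_def)
qed

lemma polyV_sum: "(\<And>i. i \<in> A \<Longrightarrow> f i \<in> polyV V) \<Longrightarrow> sum f A \<in> polyV V"
  by (induction A rule: infinite_finite_induct) (auto simp: polyV_0 polyV_add)

lemma polyV_prod: "(\<And>i. i \<in> A \<Longrightarrow> f i \<in> polyV V) \<Longrightarrow> prod f A \<in> polyV V"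
  by (induction A rule: infinite_finite_induct) (auto simp: polyV_1 polyV_mult)

lemma polyV_power: "f \<in> polyV V \<Longrightarrow> f ^ k \<in> polyV V"
  by (induction k) (auto simp: polyV_1 polyV_mult)

lemma polyV_of_int: "of_int z \<in> polyV V"
  using polyV_single[of 0 V "of_int z"] by simp

lemma polyV_Var: "(i, j) \<in> V \<Longrightarrow> Var i j \<in> polyV V"
  unfolding Var_def by (rule polyV_single) simp

definition mono_eval :: "(nat \<times> nat \<Rightarrow> 'r::comm_ring_1) \<Rightarrow> ((nat \<times> nat) \<Rightarrow>\<^sub>0 nat) \<Rightarrow> 'r" where
  "mono_eval q e = (\<Prod>v\<in>mkeys e. q v ^ coef e v)"

lemma mono_eval_superset:
  assumes "finite V" "mkeys e \<subseteq> V"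
  shows "mono_eval q e = (\<Prod>v\<in>V. q v ^ coef e v)"
  unfolding mono_eval_def
  by (rule prod.mono_neutral_left) (use assms in \<open>auto simp: in_keys_iff\<close>)

lemma mono_eval_add: "mono_eval q (e + e') = mono_eval q e * mono_eval q e'"
proof -
  let ?V = "mkeys e \<union> mkeys e'"
  have "mono_eval q (e + e') = (\<Prod>v\<in>?V. q v ^ coef (e + e') v)"
    by (rule mono_eval_superset) (use keys_add[of e e'] in auto)
  also have "\<dots> = (\<Prod>v\<in>?V. q v ^ coef e v) * (\<Prod>v\<in>?V. q v ^ coef e' v)"
    by (simp add: lookup_add power_add prod.distrib)
  finally show ?thesis by (simp add: mono_eval_superset[of ?V])
qed

text \<open>The coefficient map is an argument so that one evaluation covers points over an
  extension field, families of points with polynomial entries, and substitutions inside the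
  polynomial ring.\<close>

definition mev :: "('k \<Rightarrow> 'r) \<Rightarrow> (nat \<times> nat \<Rightarrow> 'r) \<Rightarrow> 'k::comm_ring_1 mpoly \<Rightarrow> 'r::comm_ring_1" where
  "mev h q f = (\<Sum>e\<in>mkeys f. h (coef f e) * mono_eval q e)"

context comm_ring_hom
begin

lemma mev_superset:
  assumes "finite E" "mkeys f \<subseteq> E"
  shows "mev hom q f = (\<Sum>e\<in>E. hom (coef f e) * mono_eval q e)"
  unfolding mev_def
  by (rule sum.mono_neutral_left) (use assms in \<open>auto simp: in_keys_iff\<close>)

lemma mev_0 [simp]: "mev hom q 0 = 0" by (simp add: mev_def)

lemma mev_add: "mev hom q (f + g) = mev hom q f + mev hom q g"
proof -
  let ?E = "mkeys f \<union> mkeys g"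
  have "mev hom q (f + g) = (\<Sum>e\<in>?E. hom (coef (f + g) e) * mono_eval q e)"
    by (rule mev_superset) (use keys_add[of f g] in auto)
  then show ?thesis
    by (simp add: mev_superset[of ?E] lookup_add hom_add algebra_simps sum.distrib)
qed

lemma mev_single: "mev hom q (mterm e c) = hom c * mono_eval q e"
  by (cases "c = 0") (simp_all add: mev_def)

lemma mev_mult: "mev hom q (f * g) = mev hom q f * mev hom q g"
proof (induction f rule: mpoly_induct)
  case (monomial e c)
  show ?case
    by (induction g rule: mpoly_induct)
      (simp_all add: mult_single mev_single mono_eval_add hom_mult mev_add algebra_simps)
qed (simp_all add: mev_add algebra_simps)

lemma mev_1: "mev hom q 1 = 1"
  using mev_single[of q 0 1] by (simp add: mono_eval_def)

lemma mev_hom: "comm_ring_hom (mev hom q)"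
  by unfold_locales (simp_all add: mev_add mev_mult mev_1)

lemma mev_Var: "mev hom q (Var i j) = q (i, j)"
  by (simp add: Var_def mev_single mono_eval_def)

lemma mev_cong:
  assumes "f \<in> polyV V" "\<And>v. v \<in> V \<Longrightarrow> q v = q' v"
  shows "mev hom q f = mev hom q' f"
  using assms(1)
proof (induction rule: polyV_induct)
  case (monomial e c)
  then show ?case using assms(2)
    by (auto simp: mev_single mono_eval_def intro!: arg_cong2[of _ _ _ _ "(*)"] prod.cong)
qed (simp_all add: mev_add)

lemma mev_comp:
  assumes "comm_ring_hom \<theta>"
  shows "\<theta> (mev hom q f) = mev (\<theta> \<circ> hom) (\<theta> \<circ> q) f"
proof -
  interpret t: comm_ring_hom \<theta> by fact
  show ?thesis
    by (simp add: mev_def t.hom_sum t.hom_mult mono_eval_def t.hom_prod t.hom_power)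
qed

end

definition minor_fun :: "nat \<Rightarrow> (nat \<Rightarrow> nat \<Rightarrow> 'r::comm_ring_1) \<Rightarrow> 'r" where
  "minor_fun r A = (\<Sum>\<pi> | \<pi> permutes {..<r}. of_int (sign \<pi>) * (\<Prod>i<r. A i (\<pi> i)))"

lemma minor_eq_minor_fun: "minor r R C = minor_fun r (\<lambda>i j. Var (R i) (C j))"
  by (simp add: minor_def minor_fun_def)

lemma (in comm_ring_hom) mev_minor: "mev hom q (minor r R C) = minor_fun r (\<lambda>i j. q (R i, C j))"
proof -
  interpret m: comm_ring_hom "mev hom q" by (rule mev_hom)
  show ?thesis
    by (simp add: minor_def minor_fun_def m.hom_sum m.hom_mult m.hom_prod mev_Var)
qed

lemma minor_fun_det: "minor_fun r A = det (mat r r (\<lambda>(i, j). A i j))"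
  unfolding minor_fun_def det_def
  by (auto simp: atLeast0LessThan intro!: sum.cong arg_cong2[of _ _ _ _ "(*)"] prod.cong
      dest: permutes_in_image[of _ "{..<r}"])

subsection \<open>Ideals\<close>

definition idl :: "(nat \<times> nat) set \<Rightarrow> 'k::comm_ring_1 mpoly set \<Rightarrow> 'k mpoly set" where
  "idl V G = {(\<Sum>g\<in>A. c g * g) | c A. finite A \<and> A \<subseteq> G \<and> (\<forall>g\<in>A. c g \<in> polyV V)}"

lemma ideal_genS_eq_idl: "ideal_genS m n G = idl (grid m n) G"
  by (simp add: ideal_genS_def idl_def polyS_eq_polyV)

lemma idl_induct [consumes 1, case_names zero gen add]:
  assumes "f \<in> idl V G" "P 0" "\<And>c g. c \<in> polyV V \<Longrightarrow> g \<in> G \<Longrightarrow> P (c * g)"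
    "\<And>f g. P f \<Longrightarrow> P g \<Longrightarrow> P (f + g)"
  shows "P f"
proof -
  obtain c A where f: "f = (\<Sum>g\<in>A. c g * g)" and A: "finite A" "A \<subseteq> G" "\<forall>g\<in>A. c g \<in> polyV V"
    using assms(1) by (auto simp: idl_def)
  show ?thesis unfolding f using A
    by (induction A rule: finite_induct) (auto intro: assms(2-))
qed

lemma idl_gen: "c \<in> polyV V \<Longrightarrow> g \<in> G \<Longrightarrow> c * g \<in> idl V G"
  unfolding idl_def by (rule CollectI, rule exI[of _ "\<lambda>_. c"], rule exI[of _ "{g}"]) auto

lemma idl_0: "0 \<in> idl V G"
  unfolding idl_def by (rule CollectI, rule exI[of _ "\<lambda>_. 0"], rule exI[of _ "{}"]) auto

lemma idl_add:
  assumes "f \<in> idl V G" "g \<in> idl V G"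
  shows "f + g \<in> idl V G"
proof -
  obtain c A where f: "f = (\<Sum>g\<in>A. c g * g)" and A: "finite A" "A \<subseteq> G" "\<forall>g\<in>A. c g \<in> polyV V"
    using assms(1) by (auto simp: idl_def)
  obtain d B where g: "g = (\<Sum>g\<in>B. d g * g)" and B: "finite B" "B \<subseteq> G" "\<forall>g\<in>B. d g \<in> polyV V"
    using assms(2) by (auto simp: idl_def)
  define e where "e x = (if x \<in> A then c x else 0) + (if x \<in> B then d x else 0)" for x
  have "f = (\<Sum>x\<in>A \<union> B. (if x \<in> A then c x else 0) * x)"
    unfolding f using A B by (intro sum.mono_neutral_cong_left) auto
  moreover have "g = (\<Sum>x\<in>A \<union> B. (if x \<in> B then d x else 0) * x)"
    unfolding g using A B by (intro sum.mono_neutral_cong_left) auto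
  ultimately have "f + g = (\<Sum>x\<in>A \<union> B. e x * x)"
    by (simp add: e_def sum.distrib algebra_simps)
  moreover have "\<forall>x\<in>A \<union> B. e x \<in> polyV V"
    using A B by (auto simp: e_def polyV_add)
  ultimately show ?thesis using A B unfolding idl_def by blast
qed

lemma idl_mult: "f \<in> idl V G \<Longrightarrow> c \<in> polyV V \<Longrightarrow> c * f \<in> idl V G"
proof (induction rule: idl_induct)
  case (gen d g)
  then have "(c * d) * g \<in> idl V G" by (intro idl_gen polyV_mult)
  then show ?case by (simp add: mult.assoc)
qed (auto simp: idl_0 distrib_left idl_add)

lemma idl_mono: "f \<in> idl V G \<Longrightarrow> G \<subseteq> H \<Longrightarrow> V \<subseteq> W \<Longrightarrow> f \<in> idl W H"
  by (induction rule: idl_induct) (auto simp: idl_0 idl_add intro: idl_gen polyV_mono)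

lemma idl_polyV: "f \<in> idl V G \<Longrightarrow> G \<subseteq> polyV V \<Longrightarrow> f \<in> polyV V"
  by (induction rule: idl_induct) (auto simp: polyV_0 polyV_add polyV_mult)

subsection \<open>Vanishing ideals of rank conditions\<close>

lemma Var_power: "Var i j ^ k = (mterm (Poly_Mapping.single (i, j) k) 1 :: 'k::comm_ring_1 mpoly)"
  by (induction k) (simp_all add: Var_def mult_single flip: single_add)

text \<open>Powers of one variable are collected. Having \<open>F i = 0\<close> beyond
  \<open>D\<close> lets expansions of different length be added.\<close>

lemma polyV_decompose:
  fixes f :: "'k::comm_ring_1 mpoly"
  assumes "f \<in> polyV V"
  shows "\<exists>F D. (\<forall>i. F i \<in> polyV (V - {(a, b)})) \<and> (\<forall>i>D. F i = 0) \<and> f = (\<Sum>i\<le>D. Var a b ^ i * F i)"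
  using assms
proof (induction rule: polyV_induct)
  case zero
  show ?case by (rule exI[of _ "\<lambda>_. 0"]) (simp add: polyV_0)
next
  case (monomial e c)
  define k where "k = coef e (a, b)"
  define e' where "e' = e - Poly_Mapping.single (a, b) k"
  have l: "coef e' v = (if v = (a, b) then 0 else coef e v)" for v
    by (simp add: e'_def lookup_minus k_def lookup_single when_def)
  then have e: "e = Poly_Mapping.single (a, b) k + e'"
    by (intro poly_mapping_eqI) (auto simp: lookup_add lookup_single when_def k_def)
  have "mkeys e' \<subseteq> V - {(a, b)}"
    using monomial l by (auto simp: in_keys_iff split: if_splits)
  then have "mterm e' c \<in> polyV (V - {(a, b)})" by (rule polyV_single)
  moreover have "mterm e c = Var a b ^ k * mterm e' c"
    by (subst e) (simp add: Var_power mult_single)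
  then have "mterm e c = (\<Sum>i\<le>k. Var a b ^ i * (if i = k then mterm e' c else 0))"
    by (simp add: if_distrib[of "(*) _"] cong: if_cong)
  ultimately show ?case
    by (intro exI[of _ "\<lambda>i. if i = k then mterm e' c else 0"] exI[of _ k]) (auto simp: polyV_0)
next
  case (add f g)
  obtain F D where F: "\<forall>i. F i \<in> polyV (V - {(a, b)})" "\<forall>i>D. F i = 0" "f = (\<Sum>i\<le>D. Var a b ^ i * F i)"
    using add(1) by blast
  obtain G E where G: "\<forall>i. G i \<in> polyV (V - {(a, b)})" "\<forall>i>E. G i = 0" "g = (\<Sum>i\<le>E. Var a b ^ i * G i)"
    using add(2) by blast
  have "f = (\<Sum>i\<le>max D E. Var a b ^ i * F i)" unfolding F(3)
    by (rule sum.mono_neutral_left) (use F(2) in auto)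
  moreover have "g = (\<Sum>i\<le>max D E. Var a b ^ i * G i)" unfolding G(3)
    by (rule sum.mono_neutral_left) (use G(2) in auto)
  ultimately have "f + g = (\<Sum>i\<le>max D E. Var a b ^ i * (F i + G i))"
    by (simp add: sum.distrib distrib_left)
  then show ?case using F G
    by (intro exI[of _ "\<lambda>i. F i + G i"] exI[of _ "max D E"]) (auto intro: polyV_add)
qed

text \<open>Setting \<open>v\<close> to 0 is a ring homomorphism fixing \<open>h\<close> and the
  generators; applied to a representation of \<open>h\<close> it clears \<open>v\<close> from the
  coefficients.\<close>

lemma idl_restrict:
  assumes h: "h \<in> idl V G" and hV: "h \<in> polyV (V - {v})" and G: "G \<subseteq> polyV (V - {v})"
  shows "h \<in> idl (V - {v}) G"
proof -
  interpret s: comm_ring_hom "Poly_Mapping.single 0 :: 'a::comm_ring_1 \<Rightarrow> 'a mpoly"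
    by unfold_locales (simp_all add: single_add mult_single)
  define \<sigma> :: "'a mpoly \<Rightarrow> 'a mpoly" where
    "\<sigma> = mev (Poly_Mapping.single 0) (\<lambda>(i, j). if (i, j) = v then 0 else Var i j)"
  interpret \<sigma>: comm_ring_hom \<sigma> unfolding \<sigma>_def by (rule s.mev_hom)
  have mono: "mono_eval (\<lambda>(i, j). Var i j) e = mterm e 1" for e
  proof (induction e rule: update_induct)
    case const
    then show ?case by (simp add: mono_eval_def)
  next
    case (update e k c)
    have u: "Poly_Mapping.update k c e = e + Poly_Mapping.single k c"
      by (rule poly_mapping_eqI)
        (use update in \<open>auto simp: lookup_update lookup_add lookup_single when_def in_keys_iff\<close>)
    show ?case unfolding u
      by (simp only: mono_eval_add update) (cases k, use update in \<open>simp add: mono_eval_def Var_power mult_single\<close>)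
  qed
  have fixed: "\<sigma> f = f" if "f \<in> polyV (V - {v})" for f
  proof -
    have "\<sigma> f = mev (Poly_Mapping.single 0) (\<lambda>(i, j). Var i j) f"
      unfolding \<sigma>_def by (rule s.mev_cong[OF that]) auto
    also have "\<dots> = f"
      by (induction f rule: mpoly_induct) (simp_all add: s.mev_add s.mev_single mono mult_single)
    finally show ?thesis .
  qed
  have into: "\<sigma> f \<in> polyV (V - {v})" if "f \<in> polyV V" for f
    using that
  proof (induction rule: polyV_induct)
    case (monomial e c)
    have "(case w of (i, j) \<Rightarrow> if (i, j) = v then 0 else Var i j) \<in> polyV (V - {v})"
      if "w \<in> mkeys e" for w
      using that monomial by (cases w) (simp add: polyV_0, auto intro!: polyV_Var)
    then show ?case unfolding \<sigma>_def s.mev_single mono_eval_def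
      by (intro polyV_mult polyV_prod polyV_power polyV_single) auto
  qed (simp_all add: polyV_0 \<sigma>.hom_add polyV_add)
  have "\<sigma> h \<in> idl (V - {v}) G" using h
  proof (induction rule: idl_induct)
    case (gen c g)
    then have "\<sigma> g = g" using G fixed by auto
    then show ?case using gen into by (simp add: \<sigma>.hom_mult idl_gen)
  qed (simp_all add: idl_0 \<sigma>.hom_add idl_add)
  then show ?thesis using fixed[OF hV] by simp
qed

text \<open>In the Leibniz sum, permutations fixing the last index give the corner entry times the
  smaller minor; the others avoid the corner entry and form \<open>s\<close>.\<close>

lemma minor_split_corner:
  assumes "\<And>i j. i \<le> r \<Longrightarrow> j \<le> r \<Longrightarrow> (i, j) \<noteq> (r, r) \<Longrightarrow> (R i, C j) \<in> V"
  shows "\<exists>s\<in>polyV V. Var (R r) (C r) * minor r R C = (minor (Suc r) R C :: 'k::comm_ring_1 mpoly) - s"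
proof -
  let ?P = "{\<pi>. \<pi> permutes {..<Suc r}}"
  let ?g = "\<lambda>\<pi>. of_int (sign \<pi>) * (\<Prod>i<Suc r. Var (R i) (C (\<pi> i))) :: 'k mpoly"
  have fin: "finite ?P" by (rule finite_permutations) simp
  have eq: "{\<pi> \<in> ?P. \<pi> r = r} = {\<pi>. \<pi> permutes {..<r}}"
  proof (intro Set.set_eqI iffI)
    fix \<pi> assume "\<pi> \<in> {\<pi> \<in> ?P. \<pi> r = r}"
    then show "\<pi> \<in> {\<pi>. \<pi> permutes {..<r}}"
      by (auto intro!: permutes_superset[of \<pi> "{..<Suc r}"] simp: less_Suc_eq)
  next
    fix \<pi> assume "\<pi> \<in> {\<pi>. \<pi> permutes {..<r}}"
    then show "\<pi> \<in> {\<pi> \<in> ?P. \<pi> r = r}"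
      using permutes_subset[of \<pi> "{..<r}" "{..<Suc r}"] permutes_not_in[of \<pi> "{..<r}" r] by auto
  qed
  have "minor (Suc r) R C = (\<Sum>\<pi> | \<pi> \<in> ?P \<and> \<pi> r = r. ?g \<pi>) + (\<Sum>\<pi> | \<pi> \<in> ?P \<and> \<pi> r \<noteq> r. ?g \<pi>)"
    unfolding minor_def
    by (subst sum.union_disjoint[symmetric]) (use fin in \<open>auto intro!: sum.cong\<close>)
  also have "(\<Sum>\<pi> | \<pi> \<in> ?P \<and> \<pi> r = r. ?g \<pi>) = Var (R r) (C r) * minor r R C"
    unfolding eq minor_def sum_distrib_left
    by (rule sum.cong) (auto dest: permutes_not_in[of _ "{..<r}" r])
  finally have "Var (R r) (C r) * minor r R C = (minor (Suc r) R C :: 'k mpoly) - (\<Sum>\<pi> | \<pi> \<in> ?P \<and> \<pi> r \<noteq> r. ?g \<pi>)"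
    by simp
  moreover have "(\<Sum>\<pi> | \<pi> \<in> ?P \<and> \<pi> r \<noteq> r. ?g \<pi>) \<in> polyV V"
  proof (intro polyV_sum polyV_mult polyV_of_int polyV_prod polyV_Var assms)
    fix \<pi> i assume *: "\<pi> \<in> {\<pi> \<in> ?P. \<pi> r \<noteq> r}" "i \<in> {..<Suc r}"
    then have "\<pi> i \<in> {..<Suc r}" using permutes_in_image by fastforce
    with * show "i \<le> r" "\<pi> i \<le> r" "(i, \<pi> i) \<noteq> (r, r)" by auto
  qed
  ultimately show ?thesis by blast
qed

section \<open>Rank bounds as factorizations\<close>

text \<open>A factorization through \<open>r\<close> dimensions is used because row and column
  operations and deformations act directly on the factors.\<close>

definition rk_le :: "nat \<Rightarrow> nat \<Rightarrow> nat \<Rightarrow> (nat \<times> nat \<Rightarrow> 'l::field) \<Rightarrow> bool" where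
  "rk_le r a b q \<longleftrightarrow> (\<exists>Y Z. \<forall>i<a. \<forall>j<b. q (i, j) = (\<Sum>k<r. Y i k * Z k j))"

lemma rk_leI: "(\<And>i j. i < a \<Longrightarrow> j < b \<Longrightarrow> q (i, j) = (\<Sum>k<r. Y i k * Z k j)) \<Longrightarrow> rk_le r a b q"
  unfolding rk_le_def by blast

lemma rk_le_empty: "a = 0 \<or> b = 0 \<Longrightarrow> rk_le r a b q"
  by (auto simp: rk_le_def)

lemma rk_le_mono: "rk_le r a b q \<Longrightarrow> a' \<le> a \<Longrightarrow> b' \<le> b \<Longrightarrow> rk_le r a' b' q"
  unfolding rk_le_def by (meson less_le_trans)

lemma rk_le_Suc:
  assumes "rk_le r a b q" shows "rk_le (Suc r) a b q"
proof -
  obtain Y Z where "\<forall>i<a. \<forall>j<b. q (i, j) = (\<Sum>k<r. Y i k * Z k j)"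
    using assms unfolding rk_le_def by blast
  then show ?thesis by (intro rk_leI[where Y = "\<lambda>i k. if k = r then 0 else Y i k" and Z = Z]) auto
qed

lemma rk_le_cong:
  assumes "rk_le r a b q" "\<And>i j. i < a \<Longrightarrow> j < b \<Longrightarrow> q' (i, j) = q (i, j)"
  shows "rk_le r a b q'"
  using assms unfolding rk_le_def by metis

text \<open>Induction on the rows: if the first \<open>r\<close> rows are onto they have dual
  vectors, and reducing the next row against these shows whether it adds a new direction.\<close>

lemma rows_dependent_or_onto:
  fixes Z :: "nat \<Rightarrow> nat \<Rightarrow> 'l::field"
  shows "(\<exists>\<nu>. (\<exists>k<r. \<nu> k \<noteq> 0) \<and> (\<forall>j<b. (\<Sum>k<r. \<nu> k * Z k j) = 0))
    \<or> (\<forall>\<zeta>. \<exists>c. \<forall>k<r. \<zeta> k = (\<Sum>j<b. Z k j * c j))"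
proof (induction r)
  case 0
  then show ?case by simp
next
  case (Suc r)
  show ?case
  proof (cases "\<exists>\<nu>. (\<exists>k<r. \<nu> k \<noteq> 0) \<and> (\<forall>j<b. (\<Sum>k<r. \<nu> k * Z k j) = 0)")
    case True
    then obtain \<nu> where "\<exists>k<r. \<nu> k \<noteq> 0" "\<forall>j<b. (\<Sum>k<r. \<nu> k * Z k j) = 0" by blast
    then have "(\<exists>k<Suc r. (\<nu>(r := 0)) k \<noteq> 0) \<and> (\<forall>j<b. (\<Sum>k<Suc r. (\<nu>(r := 0)) k * Z k j) = 0)"
      by auto
    then show ?thesis by blast
  next
    case False
    then have onto: "\<exists>c. \<forall>k<r. \<zeta> k = (\<Sum>j<b. Z k j * c j)" for \<zeta> using Suc by blast
    have "\<forall>l. \<exists>c. \<forall>k<r. (if k = l then 1 else 0) = (\<Sum>j<b. Z k j * c j)"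
      by (intro allI onto)
    from choice[OF this] obtain c where
      "\<forall>l. \<forall>k<r. (if k = l then 1 else 0) = (\<Sum>j<b. Z k j * c l j)" ..
    then have c: "(\<Sum>j<b. Z k j * c l j) = (if k = l then 1 else 0)" if "k < r" for l k
      using that by metis
    define \<mu> where "\<mu> l = (\<Sum>j<b. Z r j * c l j)" for l
    \<comment> \<open>Row \<open>r\<close> minus the combination of earlier rows that has the same
      pairings with the dual vectors \<open>c l\<close>. If it is zero, a linear relation
      results.\<close>
    define \<rho> where "\<rho> j = Z r j - (\<Sum>l<r. \<mu> l * Z l j)" for j
    show ?thesis
    proof (cases "\<forall>j<b. \<rho> j = 0")
      case True
      define \<nu> where "\<nu> k = (if k < r then - \<mu> k else 1)" for k
      have "(\<Sum>k<Suc r. \<nu> k * Z k j) = \<rho> j" for j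
        by (simp add: \<nu>_def \<rho>_def sum_negf)
      then have "(\<exists>k<Suc r. \<nu> k \<noteq> 0) \<and> (\<forall>j<b. (\<Sum>k<Suc r. \<nu> k * Z k j) = 0)"
        using True by (auto simp: \<nu>_def intro!: exI[of _ r])
      then show ?thesis by blast
    next
      case False
      then obtain j0 where j0: "j0 < b" "\<rho> j0 \<noteq> 0" by blast
      \<comment> \<open>The unit vector at \<open>j0\<close>, corrected so that the first
        \<open>r\<close> rows annihilate it; row \<open>r\<close> then takes the nonzero value
        \<open>\<rho> j0\<close> on it.\<close>
      define d where "d j = (if j = j0 then 1 else 0) - (\<Sum>l<r. Z l j0 * c l j)" for j
      have pair: "(\<Sum>j<b. Z k j * d j) = Z k j0 - (\<Sum>l<r. Z l j0 * (\<Sum>j<b. Z k j * c l j))" for k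
      proof -
        have "(\<Sum>j<b. Z k j * d j) = (\<Sum>j<b. if j = j0 then Z k j else 0) - (\<Sum>j<b. \<Sum>l<r. Z k j * (Z l j0 * c l j))"
          unfolding sum_subtractf[symmetric]
          by (rule sum.cong) (auto simp: d_def algebra_simps sum_distrib_left)
        also have "(\<Sum>j<b. \<Sum>l<r. Z k j * (Z l j0 * c l j)) = (\<Sum>l<r. Z l j0 * (\<Sum>j<b. Z k j * c l j))"
          by (subst sum.swap) (simp add: sum_distrib_left mult_ac)
        finally show ?thesis using j0(1) by simp
      qed
      have d0: "(\<Sum>j<b. Z k j * d j) = 0" if "k < r" for k
        unfolding pair using that by (simp add: c if_distrib[of "(*) _"] cong: if_cong)
      have d1: "(\<Sum>j<b. Z r j * d j) = \<rho> j0"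
        unfolding pair \<rho>_def by (simp add: \<mu>_def mult.commute)
      have "\<exists>c. \<forall>k<Suc r. \<zeta> k = (\<Sum>j<b. Z k j * c j)" for \<zeta>
      proof -
        obtain e where e: "\<forall>k<r. \<zeta> k = (\<Sum>j<b. Z k j * e j)" using onto[of \<zeta>] ..
        define t where "t = (\<zeta> r - (\<Sum>j<b. Z r j * e j)) / \<rho> j0"
        have s: "(\<Sum>j<b. Z k j * (e j + t * d j)) = (\<Sum>j<b. Z k j * e j) + t * (\<Sum>j<b. Z k j * d j)" for k
          by (simp add: distrib_left sum.distrib sum_distrib_left mult_ac)
        have "\<forall>k<Suc r. \<zeta> k = (\<Sum>j<b. Z k j * (e j + t * d j))"
          unfolding s using e d0 d1 j0(2) by (auto simp: less_Suc_eq t_def)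
        then show ?thesis by (rule exI[of _ "\<lambda>j. e j + t * d j"])
      qed
      then show ?thesis by blast
    qed
  qed
qed

text \<open>The relation expresses row \<open>k0\<close> of \<open>Z\<close> by the other rows;
  substituting it leaves a factorization with one index fewer.\<close>

lemma rk_le_dependent:
  assumes q: "\<And>i j. i < a \<Longrightarrow> j < b \<Longrightarrow> q (i, j) = (\<Sum>k<r. Y i k * Z k j)"
    and k0: "k0 < r" "\<nu> k0 \<noteq> 0" and dep: "\<And>j. j < b \<Longrightarrow> (\<Sum>k<r. \<nu> k * Z k j) = 0"
  shows "rk_le (r - 1) a b q"
proof -
  let ?K = "{..<r} - {k0}"
  have "card ?K = r - 1" using k0 by simp
  then obtain h where h: "bij_betw h {..<r - 1} ?K"
    using ex_bij_betw_nat_finite[of ?K] by (auto simp: atLeast0LessThan)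
  let ?Y = "\<lambda>i k. Y i k - Y i k0 * (\<nu> k / \<nu> k0)"
  show ?thesis
  proof (rule rk_leI[where Y = "\<lambda>i k. ?Y i (h k)" and Z = "\<lambda>k. Z (h k)"])
    fix i j assume ij: "i < a" "j < b"
    have "\<nu> k0 * Z k0 j + (\<Sum>k\<in>?K. \<nu> k * Z k j) = 0"
      using dep[OF ij(2)] k0(1) by (simp add: sum.remove[of "{..<r}" k0])
    then have "Z k0 j = - (\<Sum>k\<in>?K. \<nu> k * Z k j) / \<nu> k0"
      using k0(2) by (simp add: field_simps add_eq_0_iff)
    also have "\<dots> = - (\<Sum>k\<in>?K. \<nu> k / \<nu> k0 * Z k j)"
      by (simp add: sum_divide_distrib)
    finally have z: "Z k0 j = - (\<Sum>k\<in>?K. \<nu> k / \<nu> k0 * Z k j)" .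
    have "q (i, j) = Y i k0 * Z k0 j + (\<Sum>k\<in>?K. Y i k * Z k j)"
      using q[OF ij] k0(1) by (simp add: sum.remove[of "{..<r}" k0])
    also have "\<dots> = (\<Sum>k\<in>?K. ?Y i k * Z k j)"
      unfolding z by (simp add: algebra_simps sum_subtractf sum_distrib_left)
    also have "\<dots> = (\<Sum>k<r - 1. ?Y i (h k) * Z (h k) j)"
      by (rule sum.reindex_bij_betw[OF h, symmetric])
    finally show "q (i, j) = (\<Sum>k<r - 1. ?Y i (h k) * Z (h k) j)" .
  qed
qed

text \<open>If the first \<open>b\<close> columns of \<open>Z\<close> span, column \<open>b\<close>
  is a combination of them, and the same combination in row \<open>a\<close> gives the corner entry.
  Otherwise the rows of \<open>Z\<close> are dependent and the inner block loses rank.\<close>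

lemma rk_le_complete_corner:
  assumes col: "rk_le r a (Suc b) q" and row: "rk_le r (Suc a) b q"
  shows "(\<exists>z. rk_le r (Suc a) (Suc b) (q((a, b) := z))) \<or> r > 0 \<and> rk_le (r - 1) a b q"
proof -
  obtain Y Z where YZ: "\<forall>i<a. \<forall>j<Suc b. q (i, j) = (\<Sum>k<r. Y i k * Z k j)"
    using col unfolding rk_le_def by blast
  obtain U W where UW: "\<forall>i<Suc a. \<forall>j<b. q (i, j) = (\<Sum>k<r. U i k * W k j)"
    using row unfolding rk_le_def by blast
  from rows_dependent_or_onto[of r b Z] show ?thesis
  proof
    assume "\<exists>\<nu>. (\<exists>k<r. \<nu> k \<noteq> 0) \<and> (\<forall>j<b. (\<Sum>k<r. \<nu> k * Z k j) = 0)"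
    then obtain \<nu> k0 where "k0 < r" "\<nu> k0 \<noteq> 0" "\<forall>j<b. (\<Sum>k<r. \<nu> k * Z k j) = 0" by blast
    then have "rk_le (r - 1) a b q" using YZ
      by (intro rk_le_dependent[where Y = Y and Z = Z and \<nu> = \<nu>]) auto
    then show ?thesis using \<open>k0 < r\<close> by auto
  next
    assume "\<forall>\<zeta>. \<exists>c. \<forall>k<r. \<zeta> k = (\<Sum>j<b. Z k j * c j)"
    from spec[OF this, of "\<lambda>k. Z k b"]
    obtain c where c: "\<forall>k<r. Z k b = (\<Sum>j<b. Z k j * c j)" ..
    define z where "z = (\<Sum>j<b. q (a, j) * c j)"
    have swap: "(\<Sum>k<r. A k * (\<Sum>j<b. B k j * c j)) = (\<Sum>j<b. (\<Sum>k<r. A k * B k j) * c j)"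
      for A and B :: "nat \<Rightarrow> nat \<Rightarrow> 'a"
      by (simp add: sum_distrib_left sum_distrib_right mult.assoc) (rule sum.swap)
    have "rk_le r (Suc a) (Suc b) (q((a, b) := z))"
    proof (rule rk_leI[where Y = U and Z = "\<lambda>k j. if j = b then \<Sum>j<b. W k j * c j else W k j"])
      fix i j assume ij: "i < Suc a" "j < Suc b"
      consider "j < b" | "i = a" "j = b" | "i < a" "j = b" using ij by linarith
      then show "(q((a, b) := z)) (i, j) =
        (\<Sum>k<r. U i k * (if j = b then \<Sum>j<b. W k j * c j else W k j))"
      proof cases
        case 1
        then show ?thesis using UW ij by simp
      next
        case 2
        then show ?thesis using UW by (simp add: swap z_def)
      next
        case 3
        \<comment> \<open>Both factorizations describe the inner block, which carries the column
          relation from \<open>Y\<close>, \<open>Z\<close> over to \<open>U\<close>,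
          \<open>W\<close>.\<close>
        have "q (i, b) = (\<Sum>k<r. Y i k * (\<Sum>j<b. Z k j * c j))"
          using YZ c 3 by simp
        also have "\<dots> = (\<Sum>j<b. q (i, j) * c j)" using YZ 3 by (simp add: swap)
        also have "\<dots> = (\<Sum>k<r. U i k * (\<Sum>j<b. W k j * c j))"
          using UW 3 by (simp add: swap)
        finally show ?thesis using 3 by simp
      qed
    qed
    then show ?thesis by blast
  qed
qed

text \<open>Padding the factors to square matrices gives the second one a zero row.\<close>

lemma minor_fun_rank_zero:
  fixes A :: "nat \<Rightarrow> nat \<Rightarrow> 'r::idom"
  assumes "\<And>i j. i < Suc r \<Longrightarrow> j < Suc r \<Longrightarrow> A i j = (\<Sum>k<r. Y i k * Z k j)"
  shows "minor_fun (Suc r) A = 0"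
proof -
  let ?n = "Suc r"
  let ?Y = "mat ?n ?n (\<lambda>(i, k). if k = r then 0 else Y i k)"
  let ?Z = "mat ?n ?n (\<lambda>(k, j). if k = r then 0 else Z k j)"
  have "mat ?n ?n (\<lambda>(i, j). A i j) = ?Y * ?Z"
    by (rule eq_matI) (auto simp: scalar_prod_def assms atLeast0LessThan)
  then have "minor_fun ?n A = det ?Y * det ?Z"
    unfolding minor_fun_det by (simp add: det_mult[of _ ?n])
  also have "?Z = mat\<^sub>r ?n ?n (\<lambda>k. if k = r then 0\<^sub>v ?n else vec ?n (\<lambda>j. Z k j))"
    by (rule eq_matI) (auto simp: mat_of_rows_def)
  also have "det \<dots> = 0" by (rule det_row_0) auto
  finally show ?thesis by simp
qed

section \<open>Ladders of rank conditions\<close>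

definition rank_locus :: "(nat \<times> nat \<times> nat) set \<Rightarrow> (nat \<times> nat \<Rightarrow> 'l::field) set" where
  "rank_locus \<Gamma> = {q. \<forall>(a, b, r)\<in>\<Gamma>. rk_le r a b q}"

definition rank_minors :: "(nat \<times> nat \<times> nat) set \<Rightarrow> 'k::comm_ring_1 mpoly set" where
  "rank_minors \<Gamma> = (\<Union>(a, b, r)\<in>\<Gamma>. minors (Suc r) a b)"

text \<open>A stage in the removal of row \<open>a\<close> (counted from 0), from right to left: only its first \<open>c\<close> entries are still
  subject to the rank conditions.  The case \<open>c = d (R - 1)\<close> makes the condition with bound \<open>R\<close> on row \<open>a\<close> redundant,
  so that one passes to \<open>R - 1\<close>.\<close>

definition ladder :: "nat \<Rightarrow> (nat \<Rightarrow> nat) \<Rightarrow> nat \<Rightarrow> nat \<Rightarrow> nat \<Rightarrow> (nat \<times> nat \<times> nat) set" where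
  "ladder N d a R c = {(a, d s, s) |s. s \<le> N} \<union> {(Suc a, d s, s) |s. s < R} \<union> {(Suc a, c, R)}"

lemma rank_locus_ladder:
  "q \<in> rank_locus (ladder N d a R c) \<longleftrightarrow>
    (\<forall>s\<le>N. rk_le s a (d s) q) \<and> (\<forall>s<R. rk_le s (Suc a) (d s) q) \<and> rk_le R (Suc a) c q"
  unfolding rank_locus_def ladder_def by blast

lemma rank_minors_ladder:
  "rank_minors (ladder N d a R c) =
    (\<Union>s\<le>N. minors (Suc s) a (d s)) \<union> (\<Union>s<R. minors (Suc s) (Suc a) (d s)) \<union> minors (Suc R) (Suc a) c"
  unfolding rank_minors_def ladder_def by blast

lemma minors_mono: "a \<le> a' \<Longrightarrow> b \<le> b' \<Longrightarrow> minors t a b \<subseteq> minors t a' b'"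
  unfolding minors_def by (blast intro: less_le_trans)

lemma minor_polyV:
  assumes "\<And>i j. i < r \<Longrightarrow> j < r \<Longrightarrow> (R i, C j) \<in> V"
  shows "minor r R C \<in> polyV V"
  unfolding minor_def
proof (intro polyV_sum polyV_mult polyV_of_int polyV_prod polyV_Var assms)
  fix \<pi> i assume "\<pi> \<in> {\<pi>. \<pi> permutes {..<r}}" "i \<in> {..<r}"
  then show "i < r" "\<pi> i < r" using permutes_in_image[of \<pi> "{..<r}" i] by auto
qed

lemma minors_polyV: "grid a b \<subseteq> V \<Longrightarrow> minors t a b \<subseteq> polyV V"
  unfolding minors_def grid_def by (auto intro!: minor_polyV)

text \<open>The new matrix is the old block bordered by zeros plus the product of the column
  \<open>(q (i, b), 1 / \<epsilon>)\<close> and the row \<open>(\<epsilon> * q (a, j), 1)\<close>,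
  which has rank one.\<close>

lemma rk_le_ext:
  fixes q :: "nat \<times> nat \<Rightarrow> 'l::field"
  assumes q: "rk_le r a b q" and \<epsilon>: "\<epsilon> \<noteq> 0"
    and q': "\<And>i j. i < a \<Longrightarrow> j < b \<Longrightarrow> q' (i, j) = q (i, j) + \<epsilon> * (q (i, b) * q (a, j))"
    "\<And>i. i < a \<Longrightarrow> q' (i, b) = q (i, b)" "\<And>j. j < b \<Longrightarrow> q' (a, j) = q (a, j)" "q' (a, b) = 1 / \<epsilon>"
  shows "rk_le (Suc r) (Suc a) (Suc b) q'"
proof -
  obtain Y Z where YZ: "\<forall>i<a. \<forall>j<b. q (i, j) = (\<Sum>k<r. Y i k * Z k j)"
    using q unfolding rk_le_def by blast
  show ?thesis
  proof (rule rk_leI[where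
        Y = "\<lambda>i k. if i < a then if k < r then Y i k else q (i, b) else if k < r then 0 else 1 / \<epsilon>" and
        Z = "\<lambda>k j. if j < b then if k < r then Z k j else \<epsilon> * q (a, j) else if k < r then 0 else 1"])
    fix i j assume "i < Suc a" "j < Suc b"
    then consider "i < a" "j < b" | "i < a" "j = b" | "i = a" "j < b" | "i = a" "j = b" by linarith
    then show "q' (i, j) = (\<Sum>k<Suc r.
        (if i < a then if k < r then Y i k else q (i, b) else if k < r then 0 else 1 / \<epsilon>) *
        (if j < b then if k < r then Z k j else \<epsilon> * q (a, j) else if k < r then 0 else 1))"
      by cases (use YZ q' \<epsilon> in \<open>simp_all add: mult_ac\<close>)
  qed
qed

text \<open>On columns left of \<open>b\<close> the change adds a multiple of row \<open>a\<close>
  to each earlier row.\<close>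

lemma rk_le_row_op:
  fixes q :: "nat \<times> nat \<Rightarrow> 'l::field"
  assumes q: "rk_le r (Suc a) b' q" and b': "b' \<le> b"
    and q': "\<And>i j. i < a \<Longrightarrow> j < b \<Longrightarrow> q' (i, j) = q (i, j) + \<epsilon> * (q (i, b) * q (a, j))"
    "\<And>j. j < b \<Longrightarrow> q' (a, j) = q (a, j)"
  shows "rk_le r (Suc a) b' q'"
proof -
  obtain Y Z where YZ: "\<forall>i<Suc a. \<forall>j<b'. q (i, j) = (\<Sum>k<r. Y i k * Z k j)"
    using q unfolding rk_le_def by blast
  show ?thesis
    by (rule rk_leI[where Y = "\<lambda>i k. if i < a then Y i k + \<epsilon> * q (i, b) * Y a k else Y i k" and Z = Z])
      (use YZ b' q' in \<open>auto simp: less_Suc_eq algebra_simps sum.distrib sum_distrib_left\<close>)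
qed

text \<open>On rows above \<open>a\<close> the same change adds a multiple of column
  \<open>b\<close> to each earlier column.\<close>

lemma rk_le_col_op:
  fixes q :: "nat \<times> nat \<Rightarrow> 'l::field"
  assumes q: "rk_le r a b' q" and b': "b < b'"
    and q': "\<And>i j. i < a \<Longrightarrow> j < b \<Longrightarrow> q' (i, j) = q (i, j) + \<epsilon> * (q (i, b) * q (a, j))"
    "\<And>i j. i < a \<Longrightarrow> b \<le> j \<Longrightarrow> q' (i, j) = q (i, j)"
  shows "rk_le r a b' q'"
proof -
  obtain Y Z where YZ: "\<forall>i<a. \<forall>j<b'. q (i, j) = (\<Sum>k<r. Y i k * Z k j)"
    using q unfolding rk_le_def by blast
  show ?thesis
  proof (rule rk_leI[where Y = Y and Z = "\<lambda>k j. if j < b then Z k j + \<epsilon> * q (a, j) * Z k b else Z k j"])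
    fix i j assume ij: "i < a" "j < b'"
    show "q' (i, j) = (\<Sum>k<r. Y i k * (if j < b then Z k j + \<epsilon> * q (a, j) * Z k b else Z k j))"
    proof (cases "j < b")
      case True
      have "q (i, b) = (\<Sum>k<r. Y i k * Z k b)" using YZ ij b' by blast
      then show ?thesis using YZ ij True q'(1)
        by (simp add: algebra_simps sum.distrib sum_distrib_left)
    qed (use YZ ij q'(2) in simp)
  qed
qed

section \<open>Points over an infinite field\<close>

text \<open>Over a finite \<open>'k\<close> a nonzero polynomial can vanish at all points, so points
  are taken in an infinite extension.\<close>

locale point_eval = comm_ring_hom emb for emb :: "'k::field \<Rightarrow> 'l::field" +
  assumes infinite_field: "infinite (UNIV :: 'l set)"
begin

abbreviation ev :: "(nat \<times> nat \<Rightarrow> 'l) \<Rightarrow> 'k mpoly \<Rightarrow> 'l" where "ev \<equiv> mev emb"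

sublocale ev: comm_ring_hom "ev q" for q by (rule mev_hom)

lemma poly_zero_of_cofinite:
  fixes P :: "'l poly"
  assumes "finite A" "\<And>x. x \<notin> A \<Longrightarrow> poly P x = 0"
  shows "P = 0"
proof (rule ccontr)
  assume "P \<noteq> 0"
  then have "finite (A \<union> {x. poly P x = 0})" using assms(1) poly_roots_finite by blast
  moreover have "A \<union> {x. poly P x = 0} = UNIV" using assms(2) by blast
  ultimately show False using infinite_field by simp
qed

lemma const_hom: "comm_ring_hom (\<lambda>c. [:emb c:])"
  by unfold_locales (simp_all add: hom_add hom_mult one_pCons)

text \<open>A matrix \<open>Q\<close> of univariate polynomials is a one-parameter family of points.
  This lets vanishing at almost all parameters pass to the parameter 0.\<close>

lemma poly_mev: "poly (mev (\<lambda>c. [:emb c:]) Q f) x = ev (\<lambda>v. poly (Q v) x) f"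
proof -
  interpret c: comm_ring_hom "\<lambda>c. [:emb c:]" by (rule const_hom)
  have "comm_ring_hom (\<lambda>p. poly p x)" by unfold_locales simp_all
  from c.mev_comp[OF this, of Q f] show ?thesis by (simp add: comp_def)
qed

lemma emb_eq_0: "emb c = 0 \<Longrightarrow> c = 0"
  using hom_mult[of c "inverse c"] by (cases "c = 0") auto

text \<open>With the other variables fixed, the expansion in \<open>z\<close> is a univariate
  polynomial vanishing on an infinite field, so all its coefficients vanish at every point.\<close>

lemma ev_eq_0_imp_0:
  assumes "finite V" "f \<in> polyV V" "\<And>q. ev q f = 0"
  shows "f = 0"
  using assms
proof (induction V arbitrary: f rule: finite_induct)
  case empty
  then have "mkeys f \<subseteq> {0}" by (auto simp: polyV_def)
  then have "f = mterm 0 (coef f 0)"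
    by (intro poly_mapping_eqI) (auto simp: lookup_single when_def in_keys_iff)
  moreover from this have "ev (\<lambda>_. 0) f = emb (coef f 0)"
    using mev_single[of "\<lambda>_. 0" 0 "coef f 0"] by (simp add: mono_eval_def)
  ultimately show ?case using empty(2) emb_eq_0 by (metis single_zero)
next
  case (insert z V)
  obtain a b where z: "z = (a, b)" by fastforce
  have V: "insert z V - {(a, b)} = V" using insert z by auto
  obtain F D where F: "\<And>i. F i \<in> polyV V" "f = (\<Sum>i\<le>D. Var a b ^ i * F i)"
    using polyV_decompose[OF insert.prems(1), of a b] unfolding V by blast
  have "F i = 0" if i: "i \<le> D" for i
  proof (rule insert.IH[OF F(1)])
    fix q
    define P where "P = (\<Sum>i\<le>D. monom (ev q (F i)) i)"
    have "P = 0"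
    proof (rule poly_zero_of_cofinite[of "{}"])
      fix x
      have "ev (q(z := x)) (F i) = ev q (F i)" for i
        by (rule mev_cong[OF F(1)]) (use insert.hyps in auto)
      then have "ev (q(z := x)) f = poly P x"
        by (simp add: F(2) ev.hom_sum ev.hom_mult ev.hom_power mev_Var z P_def poly_sum poly_monom mult.commute)
      then show "poly P x = 0" using insert.prems(2) by simp
    qed simp
    moreover have "coeff P i = ev q (F i)"
      using i by (simp add: P_def coeff_sum)
    ultimately show "ev q (F i) = 0" by simp
  qed
  then show ?case by (simp add: F(2))
qed

lemma ev_minors_rk_le:
  assumes "g \<in> minors (Suc r) a b" "rk_le r a b q"
  shows "ev q g = 0"
proof -
  obtain R C where g: "g = minor (Suc r) R C" "\<forall>i<Suc r. R i < a \<and> C i < b"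
    using assms(1) unfolding minors_def by blast
  obtain Y Z where "\<forall>i<a. \<forall>j<b. q (i, j) = (\<Sum>k<r. Y i k * Z k j)"
    using assms(2) unfolding rk_le_def by blast
  then show ?thesis unfolding g mev_minor using g(2)
    by (intro minor_fun_rank_zero[where Y = "\<lambda>i. Y (R i)" and Z = "\<lambda>k j. Z k (C j)"]) auto
qed

lemma ev_rank_minors:
  assumes "f \<in> idl V (rank_minors \<Gamma>)" "q \<in> rank_locus \<Gamma>"
  shows "ev q f = 0"
  using assms(1)
proof (induction rule: idl_induct)
  case (gen c g)
  then obtain a b r where "(a, b, r) \<in> \<Gamma>" "g \<in> minors (Suc r) a b"
    unfolding rank_minors_def by blast
  then show ?case using assms(2) ev_minors_rk_le unfolding rank_locus_def by (auto simp: ev.hom_mult)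
qed (simp_all add: ev.hom_add)

text \<open>The point \<open>q\<close> is the limit, as \<open>\<epsilon>\<close> tends to 0, of points of the larger locus whose
  corner entry is \<open>1 / \<epsilon>\<close>; hence the leading coefficient with respect to the corner vanishes there.\<close>

lemma lead_coeff_vanishes:
  assumes d: "\<And>s s'. s \<le> s' \<Longrightarrow> s' \<le> N \<Longrightarrow> d s \<le> d s'"
    and R: "Suc R \<le> N" and c: "d R \<le> c" "Suc c \<le> d (Suc R)"
    and F: "\<And>i. F i \<in> polyV (grid m n - {(a, c)})"
    and van: "\<And>q. q \<in> rank_locus (ladder N d a (Suc R) (Suc c)) \<Longrightarrow> ev q (\<Sum>i\<le>D. Var a c ^ i * F i) = 0"
    and q: "q \<in> rank_locus (ladder N (d(R := c)) a R (d R))"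
  shows "ev q (F D) = 0"
proof -
  have q1: "rk_le s a (d s) q" if "s \<le> N" "s \<noteq> R" for s
    using q that by (auto simp: rank_locus_ladder split: if_splits)
  have "rk_le R a ((d(R := c)) R) q" using q R unfolding rank_locus_ladder by (meson Suc_leD)
  then have q2: "rk_le R a c q" by simp
  have q3: "rk_le s (Suc a) (d s) q" if "s \<le> R" for s
    using q that by (cases "s = R") (auto simp: rank_locus_ladder)
  \<comment> \<open>At parameter 0 this family is \<open>q\<close>. Resetting the corner to
    \<open>1 / \<epsilon>\<close> moves its other members into the larger locus.\<close>
  define Q where "Q v = (if fst v < a \<and> snd v < c then [:q v, q (fst v, c) * q (a, snd v):] else [:q v:])" for v
  \<comment> \<open>The factor \<open>\<epsilon> ^ D\<close> clears the powers of
    \<open>1 / \<epsilon>\<close>; at parameter 0 only the leading coefficient survives.\<close>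
  define P where "P = (\<Sum>i\<le>D. monom 1 (D - i) * mev (\<lambda>c. [:emb c:]) Q (F i))"
  have "P = 0"
  proof (rule poly_zero_of_cofinite[of "{0}"])
    fix \<epsilon> :: 'l assume "\<epsilon> \<notin> {0}"
    then have \<epsilon>: "\<epsilon> \<noteq> 0" by simp
    define q' where "q' = (\<lambda>v. poly (Q v) \<epsilon>)((a, c) := 1 / \<epsilon>)"
    have in_block: "q' (i, j) = q (i, j) + \<epsilon> * (q (i, c) * q (a, j))" if "i < a" "j < c" for i j
      using that by (simp add: q'_def Q_def mult_ac)
    have out_block: "q' (i, j) = q (i, j)" if "\<not> (i < a \<and> j < c)" "(i, j) \<noteq> (a, c)" for i j
      using that by (auto simp: q'_def Q_def)
    \<comment> \<open>Blocks ending at or left of column \<open>c\<close> see the change as a row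
      operation with row \<open>a\<close>.\<close>
    have low: "rk_le s (Suc a) (d s) q'" if "s \<le> R" for s
      by (rule rk_le_row_op[OF q3[OF that] _ in_block out_block])
        (use d[OF that] R c in auto)
    have "q' \<in> rank_locus (ladder N d a (Suc R) (Suc c))"
      unfolding rank_locus_ladder
    proof (intro conjI allI impI)
      fix s assume s: "s \<le> N"
      show "rk_le s a (d s) q'"
      proof (cases "s \<le> R")
        case True
        then show ?thesis using rk_le_mono[OF low] by simp
      next
        case False
        \<comment> \<open>Wider blocks contain column \<open>c\<close>, so above row
          \<open>a\<close> they see the change as a column operation.\<close>
        then have "c < d s" using d[of "Suc R" s] s c by simp
        from rk_le_col_op[OF q1 this in_block out_block] show ?thesis using False s by auto
      qed
    next
      fix s assume "s < Suc R"
      then show "rk_le s (Suc a) (d s) q'" using low by simp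
    next
      show "rk_le (Suc R) (Suc a) (Suc c) q'"
        by (rule rk_le_ext[OF q2 \<epsilon> in_block out_block out_block]) (simp_all add: q'_def)
    qed
    then have "0 = \<epsilon> ^ D * ev q' (\<Sum>i\<le>D. Var a c ^ i * F i)" using van by simp
    also have "\<dots> = (\<Sum>i\<le>D. \<epsilon> ^ D * ((1 / \<epsilon>) ^ i * ev q' (F i)))"
      by (simp add: ev.hom_sum ev.hom_mult ev.hom_power mev_Var q'_def sum_distrib_left)
    also have "\<dots> = (\<Sum>i\<le>D. \<epsilon> ^ (D - i) * poly (mev (\<lambda>c. [:emb c:]) Q (F i)) \<epsilon>)"
    proof (rule sum.cong)
      fix i assume "i \<in> {..D}"
      then have "\<epsilon> ^ D * (1 / \<epsilon>) ^ i = \<epsilon> ^ (D - i)"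
        using \<epsilon> by (simp add: power_diff power_divide)
      moreover have "ev q' (F i) = ev (\<lambda>v. poly (Q v) \<epsilon>) (F i)"
        by (rule mev_cong[OF F]) (auto simp: q'_def)
      ultimately show "\<epsilon> ^ D * ((1 / \<epsilon>) ^ i * ev q' (F i)) =
          \<epsilon> ^ (D - i) * poly (mev (\<lambda>c. [:emb c:]) Q (F i)) \<epsilon>"
        by (simp add: poly_mev flip: mult.assoc)
    qed simp
    also have "\<dots> = poly P \<epsilon>" by (simp add: P_def poly_sum poly_monom)
    finally show "poly P \<epsilon> = 0" by simp
  qed simp
  then have "0 = poly P 0" by simp
  also have "\<dots> = (\<Sum>i\<le>D. 0 ^ (D - i) * poly (mev (\<lambda>c. [:emb c:]) Q (F i)) 0)"
    by (simp add: P_def poly_sum poly_monom)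
  also have "\<dots> = (\<Sum>i\<le>D. if i = D then poly (mev (\<lambda>c. [:emb c:]) Q (F i)) 0 else 0)"
    by (rule sum.cong) auto
  also have "\<dots> = ev (\<lambda>v. poly (Q v) 0) (F D)" by (simp add: poly_mev)
  also have "(\<lambda>v. poly (Q v) 0) = q" by (auto simp: Q_def)
  finally show ?thesis by simp
qed

text \<open>Either the corner entry can be changed to reach the larger locus, which \<open>F\<close>
  does not notice, or the inner block has rank at most \<open>R - 1\<close>, and then
  \<open>F\<close> is treated as its own leading coefficient with \<open>D = 0\<close>.\<close>

lemma corner_free_vanishes:
  assumes d: "\<And>s s'. s \<le> s' \<Longrightarrow> s' \<le> N \<Longrightarrow> d s \<le> d s'"
    and R: "R \<le> N" and c: "R > 0 \<Longrightarrow> d (R - 1) \<le> c" "Suc c \<le> d R"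
    and F: "F \<in> polyV (grid m n - {(a, c)})"
    and van: "\<And>q. q \<in> rank_locus (ladder N d a R (Suc c)) \<Longrightarrow> ev q F = 0"
    and q: "q \<in> rank_locus (ladder N d a R c)"
  shows "ev q F = 0"
proof -
  have q1: "rk_le s a (d s) q" if "s \<le> N" for s using q that by (auto simp: rank_locus_ladder)
  have q2: "rk_le s (Suc a) (d s) q" if "s < R" for s using q that by (auto simp: rank_locus_ladder)
  have q3: "rk_le R (Suc a) c q" using q by (auto simp: rank_locus_ladder)
  have "rk_le R a (Suc c) q" using rk_le_mono[OF q1[OF R]] c by simp
  from rk_le_complete_corner[OF this q3] show ?thesis
  proof
    assume "\<exists>z. rk_le R (Suc a) (Suc c) (q((a, c) := z))"
    then obtain z where z: "rk_le R (Suc a) (Suc c) (q((a, c) := z))" ..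
    have "q((a, c) := z) \<in> rank_locus (ladder N d a R (Suc c))"
      unfolding rank_locus_ladder
    proof (intro conjI allI impI z)
      fix s assume "s \<le> N"
      then show "rk_le s a (d s) (q((a, c) := z))" by (rule rk_le_cong[OF q1]) auto
    next
      fix s assume s: "s < R"
      then have "s \<le> R - 1" "R - 1 \<le> N" "0 < R" using R by auto
      then have "d s \<le> c" using d[of s "R - 1"] c(1) by linarith
      then show "rk_le s (Suc a) (d s) (q((a, c) := z))"
        by (intro rk_le_cong[OF q2[OF s]]) auto
    qed
    then have "ev (q((a, c) := z)) F = 0" by (rule van)
    moreover have "ev (q((a, c) := z)) F = ev q F"
      by (rule mev_cong[OF F]) auto
    ultimately show ?thesis by simp
  next
    assume "0 < R \<and> rk_le (R - 1) a c q"
    then obtain R' where R': "R = Suc R'" "rk_le R' a c q" by (cases R) auto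
    have "q \<in> rank_locus (ladder N (d(R' := c)) a R' (d R'))"
      unfolding rank_locus_ladder using q1 q2 R' by auto
    then show ?thesis
      using lead_coeff_vanishes[of N d R' c "\<lambda>_. F" m n a 0 q] d R c F van R' by simp
  qed
qed

end

text \<open>Generators that are not already in the target are minors of size \<open>Suc R\<close> of
  the top left \<open>a\<close> by \<open>c\<close> block. Times the corner variable, such a minor
  is, up to terms free of the corner, the larger minor bordered by row \<open>a\<close> and column
  \<open>c\<close>.\<close>

lemma lead_coeff_lift:
  assumes R: "Suc R \<le> N" and c: "\<And>s. s \<le> R \<Longrightarrow> d s \<le> c" "Suc c \<le> n" and a: "Suc a \<le> m"
    and dn: "\<And>s. s \<le> N \<Longrightarrow> d s \<le> n"
    and h: "h \<in> idl (grid m n) (rank_minors (ladder N (d(R := c)) a R (d R)))"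
    and hz: "h \<in> polyV (grid m n - {(a, c)})"
  shows "\<exists>E\<in>idl (grid m n) (rank_minors (ladder N d a (Suc R) (Suc c))).
    \<exists>r\<in>polyV (grid m n - {(a, c)}). Var a c * h = E + (r :: 'k::comm_ring_1 mpoly)"
proof -
  let ?V = "grid m n - {(a, c)}" and ?G = "rank_minors (ladder N (d(R := c)) a R (d R)) :: 'k mpoly set"
  let ?I = "idl (grid m n) (rank_minors (ladder N d a (Suc R) (Suc c))) :: 'k mpoly set"
  have "?G \<subseteq> polyV ?V"
    unfolding rank_minors_ladder
  proof (intro Un_least UN_least minors_polyV)
    fix s assume "s \<in> {..N}"
    then show "grid a ((d(R := c)) s) \<subseteq> ?V"
      using dn[of s] a c(2) by (auto simp: grid_def)
  next
    fix s assume "s \<in> {..<R}"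
    then show "grid (Suc a) ((d(R := c)) s) \<subseteq> ?V"
      using c(1)[of s] a c(2) by (auto simp: grid_def)
  next
    show "grid (Suc a) (d R) \<subseteq> ?V" using c(1)[of R] a c(2) by (auto simp: grid_def)
  qed
  \<comment> \<open>The coefficients must be free of the corner variable too, so that the remainder
    \<open>k * s\<close> below is.\<close>
  with h hz have "h \<in> idl ?V ?G" by (rule idl_restrict)
  then show ?thesis
  proof (induction rule: idl_induct)
    case zero
    show ?case by (rule bexI[of _ 0], rule bexI[of _ 0]) (simp_all add: idl_0 polyV_0)
  next
    case (add f g)
    then obtain E r E' r' where "E \<in> ?I" "r \<in> polyV ?V" "Var a c * f = E + r"
      "E' \<in> ?I" "r' \<in> polyV ?V" "Var a c * g = E' + r'" by blast
    then show ?case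
      by (intro bexI[of _ "E + E'"] bexI[of _ "r + r'"])
        (simp_all add: idl_add polyV_add algebra_simps)
  next
    case (gen k g)
    have k: "k \<in> polyV (grid m n)" using gen(1) by (rule polyV_mono[rotated]) auto
    have z: "Var a c \<in> polyV (grid m n)" using a c(2) by (intro polyV_Var) (auto simp: grid_def)
    consider "g \<in> rank_minors (ladder N d a (Suc R) (Suc c))" | "g \<in> minors (Suc R) a c"
      using gen(2) unfolding rank_minors_ladder
      by (fastforce split: if_splits)
    then show ?case
    proof cases
      case 1
      have "Var a c * (k * g) \<in> ?I" using 1 k z by (intro idl_mult idl_gen)
      then show ?thesis by (intro bexI[of _ "Var a c * (k * g)"] bexI[of _ 0]) (simp_all add: polyV_0)
    next
      case 2
      then obtain \<rho> \<gamma> where g: "g = minor (Suc R) \<rho> \<gamma>"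
        and mono: "strict_mono_on {..<Suc R} \<rho>" "strict_mono_on {..<Suc R} \<gamma>"
        and bd: "\<And>i. i < Suc R \<Longrightarrow> \<rho> i < a \<and> \<gamma> i < c"
        unfolding minors_def by blast
      define \<rho>' where "\<rho>' = \<rho>(Suc R := a)"
      define \<gamma>' where "\<gamma>' = \<gamma>(Suc R := c)"
      \<comment> \<open>A minor of size \<open>Suc R\<close> reads only indices below
        \<open>Suc R\<close>, so the appended row and column leave it unchanged.\<close>
      have g': "g = minor (Suc R) \<rho>' \<gamma>'"
        unfolding g minor_eq_minor_fun minor_fun_det
        by (rule arg_cong[of _ _ det], rule eq_matI) (auto simp: \<rho>'_def \<gamma>'_def)
      have "(minor (Suc (Suc R)) \<rho>' \<gamma>' :: 'k mpoly) \<in> minors (Suc (Suc R)) (Suc a) (Suc c)"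
        unfolding minors_def
      proof (rule CollectI, rule exI[of _ \<rho>'], rule exI[of _ \<gamma>'], intro conjI)
        show "strict_mono_on {..<Suc (Suc R)} \<rho>'" "strict_mono_on {..<Suc (Suc R)} \<gamma>'"
          using mono bd by (auto simp: strict_mono_on_def \<rho>'_def \<gamma>'_def less_Suc_eq)
        show "\<forall>i<Suc (Suc R). \<rho>' i < Suc a \<and> \<gamma>' i < Suc c"
          using bd by (auto simp: \<rho>'_def \<gamma>'_def less_Suc_eq)
      qed simp
      then have M: "k * minor (Suc (Suc R)) \<rho>' \<gamma>' \<in> ?I"
        using k by (intro idl_gen) (auto simp: rank_minors_ladder)
      have "\<exists>s\<in>polyV ?V. Var (\<rho>' (Suc R)) (\<gamma>' (Suc R)) * minor (Suc R) \<rho>' \<gamma>' =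
          (minor (Suc (Suc R)) \<rho>' \<gamma>' :: 'k mpoly) - s"
      proof (rule minor_split_corner)
        fix i j assume "i \<le> Suc R" "j \<le> Suc R" "(i, j) \<noteq> (Suc R, Suc R)"
        then show "(\<rho>' i, \<gamma>' j) \<in> ?V"
          using bd[of i] bd[of j] a c(2) by (auto simp: \<rho>'_def \<gamma>'_def grid_def)
      qed
      then obtain s where s: "s \<in> polyV ?V" "Var a c * g = minor (Suc (Suc R)) \<rho>' \<gamma>' - s"
        unfolding g' by (auto simp: \<rho>'_def \<gamma>'_def)
      have "Var a c * (k * g) = k * minor (Suc (Suc R)) \<rho>' \<gamma>' + - (k * s)"
        by (simp only: mult.left_commute[of "Var a c" k] s(2)) (simp add: right_diff_distrib)
      moreover have "- (k * s) \<in> polyV ?V" using gen(1) s(1) by (intro polyV_uminus polyV_mult)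
      ultimately show ?thesis using M by blast
    qed
  qed
qed

section \<open>Vanishing ideals of ladders\<close>

context point_eval
begin

text \<open>Lexicographic induction on \<open>(a, R, c)\<close>: pass to the previous row, lower
  \<open>R\<close> when its condition is implied, or remove the corner \<open>(a, c')\<close>. In
  the last case an inner induction lowers the degree in the corner variable.\<close>

lemma vanishing_ladder:
  assumes "R \<le> N" "\<And>s s'. s \<le> s' \<Longrightarrow> s' \<le> N \<Longrightarrow> d s \<le> d s'" "\<And>s. s \<le> N \<Longrightarrow> d s \<le> n"
    and "R > 0 \<Longrightarrow> d (R - 1) \<le> c" "c \<le> d R" "Suc a \<le> m"
    and "f \<in> polyV (grid m n)"
    and "\<And>q. q \<in> rank_locus (ladder N d a R c) \<Longrightarrow> ev q f = 0"
  shows "f \<in> idl (grid m n) (rank_minors (ladder N d a R c))"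
  using assms
proof (induction "(a, R, c)" arbitrary: a R c d f rule: wf_induct_rule[OF
      wf_lex_prod[OF wf_less_than wf_lex_prod[OF wf_less_than wf_less_than]]])
  case (1 a R c d f)
  note IH = 1(1) and R = 1(2) and d = 1(3) and dn = 1(4) and dc = 1(5) and c = 1(6) and a = 1(7)
    and f = 1(8) and van = 1(9)
  consider "R = 0" "c = 0" | R' where "R = Suc R'" "c = d R'" | c' where "c = Suc c'" "R > 0 \<longrightarrow> d (R - 1) \<le> c'"
  proof (cases R)
    case 0
    then show ?thesis using that(1,3) by (cases c) auto
  next
    case (Suc R')
    then show ?thesis using that(2,3) dc by (cases "c = d R'"; cases c) auto
  qed
  then show ?case
  proof cases
    case 1
    show ?thesis
    proof (cases a)
      case 0
      have "f = 0"
      proof (rule ev_eq_0_imp_0[OF _ f])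
        have "grid m n = {..<m} \<times> {..<n}" by (auto simp: grid_def)
        then show "finite (grid m n)" by simp
        show "ev q f = 0" for q
          by (rule van) (simp add: rank_locus_ladder 0 1 rk_le_empty)
      qed
      then show ?thesis by (simp add: idl_0)
    next
      case (Suc a')
      \<comment> \<open>Row \<open>a\<close> carries no condition any more; the conditions on the
        rows above it form the full initial stage for row \<open>a'\<close>.\<close>
      have "f \<in> idl (grid m n) (rank_minors (ladder N d a' N (d N)))"
      proof (rule IH[OF _ _ d dn _ _ _ f])
        fix q :: "nat \<times> nat \<Rightarrow> 'l" assume q: "q \<in> rank_locus (ladder N d a' N (d N))"
        have "rk_le s a (d s) q" if "s \<le> N" for s
          using q that unfolding rank_locus_ladder Suc by (cases "s = N") auto
        then show "ev q f = 0"
          by (intro van) (simp add: rank_locus_ladder 1 rk_le_empty)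
      qed (use Suc a d in auto)
      then show ?thesis
      proof (rule idl_mono)
        show "rank_minors (ladder N d a' N (d N)) \<subseteq> rank_minors (ladder N d a R c)"
          using minors_mono[of a' a] unfolding rank_minors_ladder Suc by fastforce
      qed simp
    qed
  next
    case (2 R')
    \<comment> \<open>On \<open>d R'\<close> columns, rank at most \<open>R'\<close> already implies
      rank at most \<open>R\<close>.\<close>
    have "f \<in> idl (grid m n) (rank_minors (ladder N d a R' (d R')))"
    proof (rule IH[OF _ _ d dn _ _ _ f])
      fix q :: "nat \<times> nat \<Rightarrow> 'l" assume q: "q \<in> rank_locus (ladder N d a R' (d R'))"
      then show "ev q f = 0"
        by (intro van) (auto simp: rank_locus_ladder 2 less_Suc_eq intro: rk_le_Suc)
    qed (use 2 R a d in auto)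
    then show ?thesis
      by (rule idl_mono) (auto simp: rank_minors_ladder 2 less_Suc_eq)
  next
    case (3 c')
    have cn: "c \<le> n" using c dn[OF R] by simp
    let ?V = "grid m n - {(a, c')}" and ?I = "idl (grid m n) (rank_minors (ladder N d a R c)) :: 'k mpoly set"
    have z: "Var a c' \<in> (polyV (grid m n) :: 'k mpoly set)"
      using a c 3 dn[OF R] by (intro polyV_Var) (auto simp: grid_def)
    have V: "g \<in> polyV (grid m n)" if "g \<in> polyV ?V" for g :: "'k mpoly"
      using that by (rule polyV_mono[rotated]) auto
    have corner_free: "g \<in> ?I" if g: "g \<in> polyV ?V"
      and g0: "\<And>q. q \<in> rank_locus (ladder N d a R c) \<Longrightarrow> ev q g = 0" for g
    proof -
      have "g \<in> idl (grid m n) (rank_minors (ladder N d a R c'))"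
      proof (rule IH[OF _ R d dn _ _ a V[OF g]])
        fix q :: "nat \<times> nat \<Rightarrow> 'l" assume "q \<in> rank_locus (ladder N d a R c')"
        then show "ev q g = 0"
          by (rule corner_free_vanishes[OF d R _ _ g, rotated -1]) (use 3 c g0 in auto)
      qed (use 3 c in auto)
      then show ?thesis
      proof (rule idl_mono)
        show "rank_minors (ladder N d a R c') \<subseteq> rank_minors (ladder N d a R c)"
          using minors_mono[of "Suc a" "Suc a" c' c] unfolding rank_minors_ladder 3(1) by auto
      qed simp
    qed
    have claim: "(\<Sum>i\<le>D. Var a c' ^ i * F i) \<in> ?I"
      if F: "\<And>i. F i \<in> polyV ?V"
      and F0: "\<And>q. q \<in> rank_locus (ladder N d a R c) \<Longrightarrow> ev q (\<Sum>i\<le>D. Var a c' ^ i * F i) = 0" for D F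
      using that
    proof (induction D arbitrary: F)
      case 0
      then show ?case using corner_free[of "F 0"] by simp
    next
      case (Suc D)
      obtain E r where E: "E \<in> ?I" and r: "r \<in> polyV ?V" and Er: "Var a c' * F (Suc D) = E + r"
      proof (cases R)
        case 0
        \<comment> \<open>For \<open>R = 0\<close> the corner variable is itself a generator, so the
          remainder \<open>r\<close> can be 0.\<close>
        have "(Var a c' :: 'k mpoly) = minor 1 (\<lambda>_. a) (\<lambda>_. c')"
          by (simp add: minor_eq_minor_fun minor_fun_det det_single)
        also have "\<dots> \<in> minors (Suc R) (Suc a) c"
          unfolding minors_def 0 3(1)
          by (intro CollectI exI conjI) (auto simp: strict_mono_on_def)
        finally have "F (Suc D) * Var a c' \<in> ?I"
          using V[OF Suc.prems(1)] by (intro idl_gen) (auto simp: rank_minors_ladder)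
        then show ?thesis by (rule that[OF _ polyV_0]) (simp add: mult.commute)
      next
        case R': (Suc R')
        \<comment> \<open>The leading coefficient vanishes on the locus of a lexicographically
          smaller ladder, with \<open>R'\<close> in place of \<open>R\<close>.\<close>
        have "F (Suc D) \<in> idl (grid m n) (rank_minors (ladder N (d(R' := c')) a R' (d R')))"
        proof (rule IH[OF _ _ _ _ _ _ a V[OF Suc.prems(1)]])
          fix q :: "nat \<times> nat \<Rightarrow> 'l" assume "q \<in> rank_locus (ladder N (d(R' := c')) a R' (d R'))"
          then show "ev q (F (Suc D)) = 0"
            by (rule lead_coeff_vanishes[OF d _ _ _ Suc.prems(1), rotated -1])
              (use 3 c R R' Suc.prems(2) in auto)
        next
          fix s s' assume "s \<le> s'" "s' \<le> N"
          then show "(d(R' := c')) s \<le> (d(R' := c')) s'"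
            using d[of s s'] d[of s R'] d[of R s'] 3 R R' c by (cases "s' = R'"; cases "s = R'") auto
        qed (use R R' 3 dn c d[of "R' - 1" R'] cn in auto)
        moreover have "d s \<le> c'" if "s \<le> R'" for s
          using d[OF that] 3 R R' by (auto intro: order_trans)
        ultimately have "\<exists>E\<in>?I. \<exists>r\<in>polyV ?V. Var a c' * F (Suc D) = E + r"
          unfolding R' 3(1)
          by (intro lead_coeff_lift) (use 3 R R' c cn a dn Suc.prems(1) in auto)
        then show ?thesis using that by blast
      qed
      \<comment> \<open>Replacing the corner variable times \<open>F (Suc D)\<close> by
        \<open>E + r\<close> leaves an ideal element plus the term \<open>r\<close> in degree
        \<open>D\<close>.\<close>
      define F' where "F' = F(D := F D + r)"
      have "(\<Sum>i\<le>Suc D. Var a c' ^ i * F i) = (\<Sum>i\<le>D. Var a c' ^ i * F i) + Var a c' ^ D * (E + r)"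
        unfolding Er[symmetric] by (simp add: mult_ac)
      also have "\<dots> = (\<Sum>i\<le>D. Var a c' ^ i * F' i) + Var a c' ^ D * E"
        by (cases D) (simp_all add: F'_def algebra_simps)
      finally have split: "(\<Sum>i\<le>Suc D. Var a c' ^ i * F i) = (\<Sum>i\<le>D. Var a c' ^ i * F' i) + Var a c' ^ D * E" .
      have zE: "Var a c' ^ D * E \<in> ?I" using z E by (intro idl_mult polyV_power)
      have "(\<Sum>i\<le>D. Var a c' ^ i * F' i) \<in> ?I"
      proof (rule Suc.IH)
        show "F' i \<in> polyV ?V" for i using Suc.prems(1) r by (auto simp: F'_def polyV_add)
        fix q :: "nat \<times> nat \<Rightarrow> 'l" assume "q \<in> rank_locus (ladder N d a R c)"
        then show "ev q (\<Sum>i\<le>D. Var a c' ^ i * F' i) = 0"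
          using Suc.prems(2)[of q] ev_rank_minors[OF zE, of q] unfolding split ev.hom_add by simp
      qed
      then show ?case unfolding split using zE by (rule idl_add)
    qed
    obtain F D where "\<And>i. F i \<in> polyV ?V" "f = (\<Sum>i\<le>D. Var a c' ^ i * F i)"
      using polyV_decompose[OF f, of a c'] by blast
    then show ?thesis using claim van by simp
  qed
qed

theorem vanishing_detIdeal:
  assumes a: "a \<le> m" and f: "f \<in> polyS m n"
    and van: "\<And>q. rk_le r a n q \<Longrightarrow> ev q f = 0"
  shows "f \<in> detIdeal m n (Suc r) a"
proof (cases a)
  case 0
  have "f = 0"
  proof (rule ev_eq_0_imp_0)
    have "grid m n = {..<m} \<times> {..<n}" by (auto simp: grid_def)
    then show "finite (grid m n)" by simp
  qed (use f van 0 in \<open>auto simp: polyS_eq_polyV rk_le_empty\<close>)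
  then show ?thesis by (simp add: detIdeal_def ideal_genS_eq_idl idl_0)
next
  case (Suc a')
  \<comment> \<open>Zero width empties the conditions with bound below \<open>r\<close>; what
    remains amounts to rank at most \<open>r\<close> on the first \<open>a\<close> rows.\<close>
  define d where "d s = (if s < r then 0 else n)" for s
  have "f \<in> idl (grid m n) (rank_minors (ladder r d a' r n))"
    by (rule vanishing_ladder)
      (use a Suc f in \<open>auto simp: d_def polyS_eq_polyV rank_locus_ladder intro: van\<close>)
  then show ?thesis
    unfolding detIdeal_def ideal_genS_eq_idl
  proof (rule idl_mono)
    have "minors (Suc s) b 0 = {}" for s b unfolding minors_def by auto
    moreover have "minors (Suc r) a' n \<subseteq> minors (Suc r) a n" using Suc by (intro minors_mono) auto
    ultimately show "rank_minors (ladder r d a' r n) \<subseteq> minors (Suc r) a n"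
      unfolding rank_minors_ladder Suc d_def
      by (intro Un_least UN_least) (auto simp: le_less)
  qed simp
qed

end

subsection \<open>The Frobenius trace\<close>

text \<open>Makes the additivity of \<open>p\<close>-th powers available in the polynomial
  ring.\<close>

lemma CHAR_mpoly: "CHAR('k::comm_ring_1 mpoly) = CHAR('k)"
proof (rule CHAR_eqI)
  have of_nat: "(of_nat c :: 'k mpoly) = 0 \<longleftrightarrow> (of_nat c :: 'k) = 0" for c
  proof
    assume "(of_nat c :: 'k mpoly) = 0"
    moreover have "coef (of_nat c :: 'k mpoly) 0 = of_nat c" by (simp add: lookup_of_nat)
    ultimately show "(of_nat c :: 'k) = 0" by simp
  next
    assume "(of_nat c :: 'k) = 0"
    moreover have "(of_nat c :: 'k mpoly) = mterm 0 (of_nat c)" by simp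
    ultimately show "(of_nat c :: 'k mpoly) = 0" by (simp only: single_zero)
  qed
  show "(of_nat CHAR('k) :: 'k mpoly) = 0" by (simp add: of_nat)
  show "CHAR('k) dvd x" if "(of_nat x :: 'k mpoly) = 0" for x
    using that by (simp add: of_nat of_nat_eq_0_iff_char_dvd)
qed

lemma lookup_map_div: "coef (Poly_Mapping.map (\<lambda>k. k div p) e) v = coef (e :: 'a \<Rightarrow>\<^sub>0 nat) v div p"
  by (simp add: map.rep_eq when_def)

lemma lookup_map_times: "coef (Poly_Mapping.map (\<lambda>k. p * k) e) v = p * coef (e :: 'a \<Rightarrow>\<^sub>0 nat) v"
  by (simp add: map.rep_eq when_def)

lemma term_power: "mterm e c ^ k = mterm (Poly_Mapping.map (\<lambda>l. k * l) e) (c ^ k)"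
proof (induction k)
  case 0
  have "Poly_Mapping.map (\<lambda>l. 0 * l) e = 0" by (rule poly_mapping_eqI) (simp only: lookup_map_times, simp)
  then show ?case by simp
next
  case (Suc k)
  have "Poly_Mapping.map (\<lambda>l. Suc k * l) e = e + Poly_Mapping.map (\<lambda>l. k * l) e"
    by (rule poly_mapping_eqI) (simp only: lookup_map_times lookup_add, simp)
  then show ?case by (simp only: power_Suc Suc mult_single)
qed

locale perfect_char =
  fixes p :: nat and ty :: "'k::field itself"
  assumes prime_p: "prime p" and char_p: "CHAR('k) = p" and surj_p: "surj (\<lambda>x::'k. x ^ p)"
begin

lemma frob_inj: "x ^ p = y ^ p \<Longrightarrow> x = (y::'k)"
proof -
  assume eq: "x ^ p = y ^ p"
  have "((x - y) + y) ^ p = (x - y) ^ p + y ^ p"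
    by (rule freshmans_dream) (use prime_p char_p in auto)
  then show "x = y" using eq by simp
qed

lemma proot_power: "proot p (r ^ p) = (r::'k)"
  unfolding proot_def using frob_inj by blast

lemma power_proot: "proot p c ^ p = (c::'k)"
proof -
  obtain r where "c = r ^ p" using surj_p by blast
  then show ?thesis by (simp add: proot_power)
qed

lemma proot_0: "proot p (0::'k) = 0"
  using power_proot[of 0] by simp

lemma proot_1: "proot p (1::'k) = 1"
  using proot_power[of 1] by simp

lemma proot_add: "proot p (a + b) = proot p a + proot p (b::'k)"
proof (rule frob_inj)
  have "(proot p a + proot p b) ^ p = a + b"
    by (subst freshmans_dream) (use prime_p char_p in \<open>auto simp: power_proot\<close>)
  then show "proot p (a + b) ^ p = (proot p a + proot p b) ^ p" by (simp add: power_proot)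
qed

lemma proot_mult_power: "proot p (r ^ p * c) = r * proot p (c::'k)"
  by (rule frob_inj) (simp add: power_proot power_mult_distrib)

definition trace_exp :: "nat \<Rightarrow> nat \<Rightarrow> ((nat \<times> nat) \<Rightarrow>\<^sub>0 nat) \<Rightarrow> bool" where
  "trace_exp m n e \<longleftrightarrow> (\<forall>v\<in>grid m n. coef e v mod p = p - 1) \<and> (\<forall>v. v \<notin> grid m n \<longrightarrow> coef e v mod p = 0)"

definition trace_term :: "nat \<Rightarrow> nat \<Rightarrow> ((nat \<times> nat) \<Rightarrow>\<^sub>0 nat) \<Rightarrow> 'k \<Rightarrow> 'k mpoly" where
  "trace_term m n e c =
    (if trace_exp m n e then mterm (Poly_Mapping.map (\<lambda>k. k div p) e) (proot p c) else 0)"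

lemma frob_trace_superset:
  assumes "finite E" "mkeys f \<subseteq> E"
  shows "frob_trace p m n f = (\<Sum>e\<in>E. trace_term m n e (coef f e))"
  unfolding frob_trace_def trace_exp_def[symmetric] trace_term_def[symmetric]
  by (rule sum.mono_neutral_left) (use assms in \<open>auto simp: in_keys_iff trace_term_def proot_0\<close>)

lemma frob_trace_0: "frob_trace p m n (0 :: 'k mpoly) = 0"
  by (simp add: frob_trace_def)

lemma frob_trace_add: "frob_trace p m n (f + g) = frob_trace p m n f + frob_trace p m n (g :: 'k mpoly)"
proof -
  let ?E = "mkeys f \<union> mkeys g"
  have "frob_trace p m n (f + g) = (\<Sum>e\<in>?E. trace_term m n e (coef (f + g) e))"
    by (rule frob_trace_superset) (use keys_add[of f g] in auto)
  also have "\<dots> = (\<Sum>e\<in>?E. trace_term m n e (coef f e) + trace_term m n e (coef g e))"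
    by (rule sum.cong) (auto simp: trace_term_def lookup_add proot_add single_add)
  finally show ?thesis by (simp add: sum.distrib frob_trace_superset[of ?E])
qed

lemma frob_trace_term: "frob_trace p m n (mterm e c) = trace_term m n e c"
  by (subst frob_trace_superset[of "{e}"]) auto

text \<open>This is linearity over \<open>S\<close> acting through Frobenius. Both arguments reduce
  to monomials, where a \<open>p\<close>-th power shifts exponents by multiples of \<open>p\<close>
  and so preserves the residue test.\<close>

lemma frob_trace_power_mult: "frob_trace p m n (g ^ p * f) = g * frob_trace p m n (f :: 'k mpoly)"
proof (induction f rule: mpoly_induct)
  case (monomial e c)
  show ?case
  proof (induction g rule: mpoly_induct)
    case zero
    show ?case using prime_p by (simp add: power_0_left frob_trace_0 prime_gt_0_nat)
  next
    case (monomial e' d)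
    have p: "p > 0" using prime_p prime_gt_0_nat by blast
    let ?e = "Poly_Mapping.map (\<lambda>l. p * l) e' + e"
    have "trace_exp m n ?e = trace_exp m n e"
      by (simp add: trace_exp_def lookup_add lookup_map_times)
    moreover have "Poly_Mapping.map (\<lambda>k. k div p) ?e = e' + Poly_Mapping.map (\<lambda>k. k div p) e"
      using p by (intro poly_mapping_eqI) (simp only: lookup_map_div lookup_add lookup_map_times, simp)
    ultimately show ?case
      by (simp add: term_power mult_single frob_trace_term trace_term_def proot_mult_power)
  next
    case (add g g')
    have "(g + g') ^ p = g ^ p + g' ^ p"
      by (rule freshmans_dream) (use prime_p char_p in \<open>auto simp: CHAR_mpoly\<close>)
    then show ?case using add by (simp add: distrib_right frob_trace_add)
  qed
qed (simp_all add: frob_trace_0 frob_trace_add distrib_left)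

lemma frob_trace_polyV: "f \<in> polyV V \<Longrightarrow> frob_trace p m n f \<in> polyV V" for f :: "'k mpoly"
proof (induction rule: polyV_induct)
  case (monomial e c)
  have "mkeys (Poly_Mapping.map (\<lambda>k. k div p) e) \<subseteq> mkeys e"
    by (rule subsetI) (metis in_keys_iff lookup_map_div div_0)
  then have "mkeys (Poly_Mapping.map (\<lambda>k. k div p) e) \<subseteq> V"
    using monomial by blast
  then show ?case by (auto simp: frob_trace_term trace_term_def polyV_0 intro: polyV_single)
qed (simp_all add: polyV_0 frob_trace_0 frob_trace_add polyV_add)

end

subsection \<open>Leading terms with respect to a weight\<close>

text \<open>The weight of \<open>x\<^sub>i\<^sub>j\<close> is \<open>i * j\<close>.  By the rearrangement inequality the main diagonal of a minor is its
  unique monomial of maximal weight.\<close>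

definition wt :: "((nat \<times> nat) \<Rightarrow>\<^sub>0 nat) \<Rightarrow> nat" where
  "wt e = (\<Sum>v\<in>mkeys e. coef e v * (fst v * snd v))"

lemma wt_superset:
  assumes "finite V" "mkeys e \<subseteq> V"
  shows "wt e = (\<Sum>v\<in>V. coef e v * (fst v * snd v))"
  unfolding wt_def by (rule sum.mono_neutral_left) (use assms in \<open>auto simp: in_keys_iff\<close>)

lemma wt_0: "wt 0 = 0" by (simp add: wt_def)

lemma wt_add: "wt (e + e') = wt e + wt e'"
proof -
  let ?V = "mkeys e \<union> mkeys e'"
  have "wt (e + e') = (\<Sum>v\<in>?V. coef (e + e') v * (fst v * snd v))"
    by (rule wt_superset) (use keys_add[of e e'] in auto)
  then show ?thesis by (simp add: wt_superset[of ?V] lookup_add algebra_simps sum.distrib)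
qed

lemma wt_sum: "wt (sum e A) = (\<Sum>i\<in>A. wt (e i))"
  by (induction A rule: infinite_finite_induct) (simp_all add: wt_0 wt_add)

lemma wt_single: "wt (Poly_Mapping.single (i, j) k) = k * (i * j)"
  by (cases "k = 0") (simp_all add: wt_def)

text \<open>A strict weight gap replaces a monomial order: it forces coefficient 1 at
  \<open>e\<close> and is compatible with products.\<close>

definition leads :: "'k::comm_ring_1 mpoly \<Rightarrow> ((nat \<times> nat) \<Rightarrow>\<^sub>0 nat) \<Rightarrow> bool" where
  "leads f e \<longleftrightarrow> (\<forall>e'\<in>mkeys (f - mterm e 1). wt e' < wt e)"

lemma leads_1: "leads 1 0"
  by (simp add: leads_def)

lemma leads_mult:
  assumes "leads f e" "leads g e'"
  shows "leads (f * g) (e + e')"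
proof -
  define f' where "f' = f - mterm e 1"
  define g' where "g' = g - mterm e' 1"
  have f: "f = mterm e 1 + f'" and g: "g = mterm e' 1 + g'" by (simp_all add: f'_def g'_def)
  have "f * g - mterm (e + e') 1 = mterm e 1 * g' + f' * g"
    unfolding f g by (simp add: algebra_simps mult_single)
  moreover {
    fix d assume "d \<in> mkeys (mterm e 1 * g')"
    then obtain b where "b \<in> mkeys g'" "d = e + b"
      using keys_mult[of "mterm e 1" g'] by (fastforce split: if_splits)
    then have "wt d < wt (e + e')" using assms(2) by (auto simp: leads_def g'_def wt_add)
  }
  moreover {
    fix d assume "d \<in> mkeys (f' * g)"
    then obtain a b where ab: "a \<in> mkeys f'" "b \<in> mkeys g" "d = a + b"
      using keys_mult[of f' g] by blast
    have "b = e' \<or> b \<in> mkeys g'" using ab(2) keys_add[of "mterm e' 1" g'] unfolding g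
      by (auto split: if_splits)
    then have "wt b \<le> wt e'" using assms(2) by (auto simp: leads_def g'_def intro: less_imp_le)
    then have "wt d < wt (e + e')" using ab assms(1) by (fastforce simp: leads_def f'_def wt_add)
  }
  ultimately show ?thesis unfolding leads_def
    using keys_add[of "mterm e 1 * g'" "f' * g"] by fastforce
qed

lemma leads_prod: "(\<And>i. i \<in> A \<Longrightarrow> leads (f i) (e i)) \<Longrightarrow> leads (prod f A) (sum e A)"
  by (induction A rule: infinite_finite_induct) (auto simp: leads_1 leads_mult)

text \<open>For \<open>a = b = 0\<close>, twice the difference of the two sums is the sum of the
  squares of \<open>k - \<pi> k\<close>. The shifts only add terms invariant under the
  permutation.\<close>

lemma sum_mult_permutes_less:
  assumes \<pi>: "\<pi> permutes {..<r}" "\<pi> \<noteq> id"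
  shows "(\<Sum>k<r. (a + k) * (b + \<pi> k)) < (\<Sum>k<r. (a + k) * (b + k :: nat))"
proof -
  let ?i = "int"
  have perm: "(\<Sum>k<r. g (\<pi> k)) = (\<Sum>k<r. g k)" for g :: "nat \<Rightarrow> int"
    using sum.permute[OF \<pi>(1), of g] by (simp add: comp_def)
  obtain k where k: "\<pi> k \<noteq> k" using \<pi>(2) by (auto simp: fun_eq_iff)
  then have kr: "k < r" using permutes_not_in[OF \<pi>(1)] by blast
  have "0 < (?i k - ?i (\<pi> k))\<^sup>2" using k by simp
  also have "\<dots> \<le> (\<Sum>k<r. (?i k - ?i (\<pi> k))\<^sup>2)"
    using kr by (intro member_le_sum) auto
  also have "\<dots> = (\<Sum>k<r. (?i k)\<^sup>2) + (\<Sum>k<r. (?i (\<pi> k))\<^sup>2) - 2 * (\<Sum>k<r. ?i k * ?i (\<pi> k))"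
    by (simp add: power2_diff sum.distrib sum_subtractf sum_distrib_left mult_ac)
  also have "\<dots> = 2 * ((\<Sum>k<r. ?i k * ?i k) - (\<Sum>k<r. ?i k * ?i (\<pi> k)))"
    by (simp add: perm[of "\<lambda>k. ?i k * ?i k"] power2_eq_square)
  finally have "(\<Sum>k<r. ?i k * ?i (\<pi> k)) < (\<Sum>k<r. ?i k * ?i k)" by simp
  moreover have "(\<Sum>k<r. (?i a + ?i k) * (?i b + g k)) =
      (\<Sum>k<r. (?i a + ?i k) * ?i b) + ?i a * (\<Sum>k<r. g k) + (\<Sum>k<r. ?i k * g k)" for g
    by (simp add: distrib_left distrib_right sum.distrib sum_distrib_left)
  ultimately have "(\<Sum>k<r. (?i a + ?i k) * (?i b + ?i (\<pi> k))) < (\<Sum>k<r. (?i a + ?i k) * (?i b + ?i k))"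
    by (simp add: perm[of "\<lambda>k. ?i k"])
  then show ?thesis by (simp flip: of_nat_add of_nat_mult of_nat_sum)
qed

lemma prod_Var: "(\<Prod>i\<in>A. Var (R i) (C i)) = mterm (\<Sum>i\<in>A. Poly_Mapping.single (R i, C i) 1) 1"
  by (induction A rule: infinite_finite_induct) (simp_all add: Var_def mult_single)

lemma leads_minor:
  "leads (minor r (\<lambda>k. a + k) (\<lambda>k. b + k)) (\<Sum>k<r. Poly_Mapping.single (a + k, b + k) 1)"
proof -
  let ?P = "{\<pi>. \<pi> permutes {..<r}}"
  let ?e = "\<lambda>\<pi>. \<Sum>k<r. Poly_Mapping.single (a + k, b + \<pi> k) (1::nat)"
  let ?g = "\<lambda>\<pi>. of_int (sign \<pi>) * mterm (?e \<pi>) 1 :: 'a mpoly"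
  have "minor r (\<lambda>k. a + k) (\<lambda>k. b + k) = (\<Sum>\<pi>\<in>?P. ?g \<pi>)"
    by (simp add: minor_def prod_Var)
  also have "\<dots> = ?g id + (\<Sum>\<pi>\<in>?P - {id}. ?g \<pi>)"
    by (rule sum.remove) (simp_all add: finite_permutations permutes_id)
  finally have "minor r (\<lambda>k. a + k) (\<lambda>k. b + k) - mterm (?e id) 1 = (\<Sum>\<pi>\<in>?P - {id}. ?g \<pi>)"
    by (simp add: sign_id)
  moreover {
    fix d assume "d \<in> mkeys (\<Sum>\<pi>\<in>?P - {id}. ?g \<pi>)"
    then obtain \<pi> where \<pi>: "\<pi> \<in> ?P - {id}" "d \<in> mkeys (?g \<pi>)"
      using keys_sum[of ?g "?P - {id}"] by blast
    have "?g \<pi> = mterm (?e \<pi>) (of_int (sign \<pi>))"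
      by (simp only: mult_single flip: single_of_int) simp
    then have "d = ?e \<pi>" using \<pi>(2) by (simp split: if_splits)
    then have "wt d < wt (?e id)"
      using sum_mult_permutes_less[of \<pi> r a b] \<pi>(1) by (simp add: wt_sum wt_single)
  }
  ultimately show ?thesis by (simp add: leads_def)
qed

text \<open>The main diagonals of the factors partition the grid: the alphas fill the short
  diagonals at the lower left, the betas those at the upper right, and the deltas those of full
  length \<open>\<mu>\<close>.\<close>

lemma leads_Delta: "leads (Delta m n) (\<Sum>v\<in>grid m n. Poly_Mapping.single v 1)"
proof -
  define \<mu> where "\<mu> = min m n"
  define d where "d = max m n - \<mu>"
  let ?s = "\<lambda>v. Poly_Mapping.single v (1::nat)"
  have a: "leads (alpha m i) (\<Sum>k<i. ?s (m - i + k, k))" for i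
    using leads_minor[of i "m - i" 0] by (simp add: alpha_def)
  have b: "leads (beta n i) (\<Sum>k<i. ?s (k, n - i + k))" for i
    using leads_minor[of i 0 "n - i"] by (simp add: beta_def)
  define e where "e j k = (if m \<le> n then (k, j + k) else (j + k, k))" for j k :: nat
  have c: "leads (delta m n j) (\<Sum>k<\<mu>. ?s (e j k))" for j
    using leads_minor[of m 0 j] leads_minor[of n j 0] by (auto simp: delta_def \<mu>_def e_def)
  \<comment> \<open>Here \<open>m - x + y\<close> and \<open>n - y + x\<close> are the sizes of the
    alpha and beta minors whose main diagonal would pass through \<open>(x, y)\<close>.\<close>
  let ?A = "{(x, y). x < m \<and> m - x + y < \<mu>}"
  let ?B = "{(x, y). y < n \<and> n - y + x < \<mu>}"
  let ?C = "{(x, y). x < m \<and> y < n \<and> \<not> m - x + y < \<mu> \<and> \<not> n - y + x < \<mu>}"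
  have fin: "finite ?A" "finite ?B" "finite ?C"
    by (rule finite_subset[of _ "{..<m} \<times> {..<\<mu>}"], auto)
      (rule finite_subset[of _ "{..<\<mu>} \<times> {..<n}"], auto,
       rule finite_subset[of _ "{..<m} \<times> {..<n}"], auto)
  have A: "(\<Sum>i\<in>{1..<\<mu>}. \<Sum>k<i. ?s (m - i + k, k)) = (\<Sum>v\<in>?A. ?s v)"
    by (subst sum.Sigma, simp, simp)
      (rule sum.reindex_bij_witness[where i = "\<lambda>(x, y). (m - x + y, y)" and j = "\<lambda>(i, k). (m - i + k, k)"],
        auto simp: \<mu>_def)
  have B: "(\<Sum>i\<in>{1..<\<mu>}. \<Sum>k<i. ?s (k, n - i + k)) = (\<Sum>v\<in>?B. ?s v)"
    by (subst sum.Sigma, simp, simp)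
      (rule sum.reindex_bij_witness[where i = "\<lambda>(x, y). (n - y + x, x)" and j = "\<lambda>(i, k). (k, n - i + k)"],
        auto simp: \<mu>_def)
  have C: "(\<Sum>j\<in>{0..d}. \<Sum>k<\<mu>. ?s (e j k)) = (\<Sum>v\<in>?C. ?s v)"
    by (subst sum.Sigma, simp, simp)
      (rule sum.reindex_bij_witness[where
          i = "\<lambda>(x, y). if m \<le> n then (y - x, x) else (x - y, y)" and j = "\<lambda>(j, k). e j k"],
        auto simp: \<mu>_def d_def e_def split: if_splits)
  have "leads (Delta m n) ((\<Sum>v\<in>?A. ?s v) + (\<Sum>v\<in>?C. ?s v) + (\<Sum>v\<in>?B. ?s v))"
    unfolding Delta_def Let_def \<mu>_def[symmetric] d_def[symmetric] A[symmetric] B[symmetric] C[symmetric]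
    by (intro leads_mult leads_prod a b c)
  also have "(\<Sum>v\<in>?A. ?s v) + (\<Sum>v\<in>?C. ?s v) + (\<Sum>v\<in>?B. ?s v) = (\<Sum>v\<in>?A \<union> ?C \<union> ?B. ?s v)"
  proof -
    have "?A \<inter> ?C = {}" "(?A \<union> ?C) \<inter> ?B = {}" by (auto simp: \<mu>_def)
    then show ?thesis using fin by (simp add: sum.union_disjoint)
  qed
  also have "?A \<union> ?C \<union> ?B = grid m n"
    by (auto simp: grid_def \<mu>_def)
  finally show ?thesis .
qed

context perfect_char
begin

text \<open>A monomial passing the residue test has all grid exponents at least
  \<open>p - 1\<close>, hence weight at least that of \<open>e0\<close>. So only the leading
  monomial of \<open>Delta m n ^ (p - 1)\<close> contributes, and its trace is 1.\<close>

lemma phi_1: "phi p m n (1 :: 'k mpoly) = 1"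
proof -
  define e0 :: "(nat \<times> nat) \<Rightarrow>\<^sub>0 nat" where
    "e0 = (\<Sum>_<p - 1. \<Sum>v\<in>grid m n. Poly_Mapping.single v 1)"
  have "grid m n = {..<m} \<times> {..<n}" by (auto simp: grid_def)
  then have fin: "finite (grid m n)" by simp
  have p: "p > 0" using prime_p prime_gt_0_nat by blast
  have look: "coef e0 v = (if v \<in> grid m n then p - 1 else 0)" for v
    using fin by (simp add: e0_def lookup_sum lookup_single when_def)
  define g where "g = Delta m n ^ (p - 1) - (mterm e0 1 :: 'k mpoly)"
  have "leads (\<Prod>_<p - 1. Delta m n :: 'k mpoly) e0"
    unfolding e0_def by (rule leads_prod) (rule leads_Delta)
  then have g: "wt e < wt e0" if "e \<in> mkeys g" for e
    using that by (simp add: leads_def g_def)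
  have keys: "mkeys e0 \<subseteq> grid m n" by (auto simp: in_keys_iff look split: if_splits)
  have "\<not> trace_exp m n e" if "e \<in> mkeys g" for e
  proof
    assume e: "trace_exp m n e"
    have "wt e0 = (\<Sum>v\<in>grid m n. coef e0 v * (fst v * snd v))" by (rule wt_superset[OF fin keys])
    also have "\<dots> \<le> (\<Sum>v\<in>grid m n. coef e v * (fst v * snd v))"
    proof (intro sum_mono mult_right_mono)
      fix v assume v: "v \<in> grid m n"
      then have "coef e v mod p = p - 1" using e by (simp add: trace_exp_def)
      then show "coef e0 v \<le> coef e v" using v look by (metis mod_less_eq_dividend)
    qed simp
    also have "\<dots> \<le> (\<Sum>v\<in>grid m n \<union> mkeys e. coef e v * (fst v * snd v))"
      by (rule sum_mono2) (use fin in auto)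
    also have "\<dots> = wt e" by (rule wt_superset[symmetric]) (use fin in auto)
    finally show False using g[OF that] by simp
  qed
  then have "frob_trace p m n g = 0"
    by (subst frob_trace_superset[of "mkeys g"]) (auto simp: trace_term_def intro: sum.neutral)
  moreover have "trace_exp m n e0" using p by (simp add: trace_exp_def look)
  moreover have "Poly_Mapping.map (\<lambda>k. k div p) e0 = 0"
    using p by (intro poly_mapping_eqI) (simp add: lookup_map_div look)
  moreover have "phi p m n (1 :: 'k mpoly) = frob_trace p m n (mterm e0 1 + g)"
    by (simp add: phi_def g_def)
  ultimately show ?thesis
    by (simp add: frob_trace_add frob_trace_term trace_term_def proot_1)
qed

end

subsection \<open>Orders of vanishing along determinantal ideals\<close>

text \<open>For finite \<open>I\<close> this is the \<open>e\<close>-th power of the ideal generated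
  by the \<open>W v\<close>. Admitting larger total exponents makes it visibly decreasing in
  \<open>e\<close>.\<close>

definition ipow :: "('v \<Rightarrow> 'k::comm_ring_1 mpoly) \<Rightarrow> 'v set \<Rightarrow> nat \<Rightarrow> 'k mpoly set" where
  "ipow W I e = idl UNIV {\<Prod>v\<in>I. W v ^ k v |k. e \<le> sum k I}"

lemma ipow_add: "f \<in> ipow W I e \<Longrightarrow> g \<in> ipow W I e \<Longrightarrow> f + g \<in> ipow W I e"
  unfolding ipow_def by (rule idl_add)

lemma ipow_0_mem: "0 \<in> ipow W I e"
  unfolding ipow_def by (rule idl_0)

lemma ipow_scale: "f \<in> ipow W I e \<Longrightarrow> c * f \<in> ipow W I e"
  unfolding ipow_def by (rule idl_mult) (auto intro: polyV_UNIV)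

lemma ipow_sum: "(\<And>i. i \<in> A \<Longrightarrow> f i \<in> ipow W I e) \<Longrightarrow> sum f A \<in> ipow W I e"
  by (induction A rule: infinite_finite_induct) (auto simp: ipow_0_mem ipow_add)

lemma ipow_gen: "e \<le> sum k I \<Longrightarrow> c * (\<Prod>v\<in>I. W v ^ k v) \<in> ipow W I e"
  unfolding ipow_def by (rule idl_gen) (auto intro: polyV_UNIV)

lemma ipow_mono: "f \<in> ipow W I e \<Longrightarrow> e' \<le> e \<Longrightarrow> f \<in> ipow W I e'"
  unfolding ipow_def by (erule idl_mono) auto

lemma ipow_mult:
  assumes f: "f \<in> ipow W I e" and g: "g \<in> ipow W I e'"
  shows "f * g \<in> ipow W I (e + e')"
  using f[unfolded ipow_def]
proof (induction rule: idl_induct)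
  case (gen c b)
  then obtain k where b: "b = (\<Prod>v\<in>I. W v ^ k v)" and k: "e \<le> sum k I" by blast
  show ?case using g[unfolded ipow_def]
  proof (induction rule: idl_induct)
    case (gen c' b')
    then obtain k' where b': "b' = (\<Prod>v\<in>I. W v ^ k' v)" and k': "e' \<le> sum k' I" by blast
    have "c * b * (c' * b') = (c * c') * (\<Prod>v\<in>I. W v ^ (k v + k' v))"
      by (simp add: b b' power_add prod.distrib mult_ac)
    also have "\<dots> \<in> ipow W I (e + e')"
      using k k' by (intro ipow_gen) (simp add: sum.distrib)
    finally show ?case .
  qed (simp_all add: ipow_0_mem distrib_left ipow_add)
qed (simp_all add: ipow_0_mem distrib_right ipow_add)

lemma ipow_zero: "f \<in> ipow W I 0"
  using ipow_gen[of 0 "\<lambda>_. 0" I f W] by simp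

lemma ipow_one:
  assumes "finite I" "v \<in> I"
  shows "W v \<in> ipow W I 1"
proof -
  have "(\<Prod>w\<in>I. W w ^ (if w = v then 1 else 0)) = (\<Prod>w\<in>I. if w = v then W w else 1)"
    by (rule prod.cong) auto
  then have "W v = 1 * (\<Prod>w\<in>I. W w ^ (if w = v then 1 else 0))"
    using assms by simp
  also have "\<dots> \<in> ipow W I 1" by (rule ipow_gen) (use assms in simp)
  finally show ?thesis .
qed

lemma ipow_prod:
  "(\<And>i. i \<in> A \<Longrightarrow> f i \<in> ipow W I (e i)) \<Longrightarrow> prod f A \<in> ipow W I (sum e A)"
proof (induction A rule: infinite_finite_induct)
  case (insert x A)
  then show ?case by (simp add: ipow_mult)
qed (simp_all add: ipow_zero)

text \<open>After multilinear expansion, a term in which two rows of \<open>S\<close> select the same row of \<open>Z\<close> vanishes, so at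
  most \<open>r\<close> rows of \<open>S\<close> avoid the ideal generated by \<open>W\<close>.\<close>

lemma minor_fun_ipow:
  fixes A :: "nat \<Rightarrow> nat \<Rightarrow> 'k::comm_ring_1 mpoly"
  assumes S: "S \<subseteq> {..<s}"
    and A: "\<And>i j. i \<in> S \<Longrightarrow> j < s \<Longrightarrow> A i j = (\<Sum>k<r. Y i k * Z k j) + E i j"
    and E: "\<And>i j. i \<in> S \<Longrightarrow> j < s \<Longrightarrow> E i j \<in> ipow W I 1"
  shows "minor_fun s A \<in> ipow W I (card S - r)"
proof -
  \<comment> \<open>Index \<open>r\<close> stands for the error row \<open>E i\<close>, or for the
    whole row \<open>A i\<close> if \<open>i\<close> is outside \<open>S\<close>; smaller indices
    stand for the rows of \<open>Z\<close>.\<close>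
  let ?Y = "\<lambda>i k. if k = r then 1 else if i \<in> S then Y i k else 0"
  let ?Z = "\<lambda>i k j. if k = r then (if i \<in> S then E i j else A i j) else Z k j"
  let ?a = "\<lambda>i k. ?Y i k \<cdot>\<^sub>v vec s (?Z i k)"
  let ?F = "{f. (\<forall>i\<in>{0..<s}. f i \<in> {..<Suc r}) \<and> (\<forall>i. i \<notin> {0..<s} \<longrightarrow> f i = i)}"
  have row: "finsum_vec TYPE('k mpoly) s (?a i) {..<Suc r} = vec s (A i)" if "i < s" for i
  proof (rule eq_vecI)
    fix j assume "j < dim_vec (vec s (A i))"
    then have j: "j < s" by simp
    have "finsum_vec TYPE('k mpoly) s (?a i) {..<Suc r} $ j = (\<Sum>k<Suc r. ?a i k $ j)"
      by (rule index_finsum_vec) (use j in auto)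
    also have "\<dots> = A i j" using j A[of i j] by (cases "i \<in> S") auto
    finally show "finsum_vec TYPE('k mpoly) s (?a i) {..<Suc r} $ j = vec s (A i) $ j" using j by simp
  next
    have "finsum_vec TYPE('k mpoly) s (?a i) {..<Suc r} \<in> carrier_vec s"
      by (rule finsum_vec_closed) auto
    then show "dim_vec (finsum_vec TYPE('k mpoly) s (?a i) {..<Suc r}) = dim_vec (vec s (A i))" by simp
  qed
  have "mat s s (\<lambda>(i, j). A i j) = mat\<^sub>r s s (\<lambda>i. finsum_vec TYPE('k mpoly) s (?a i) {..<Suc r})"
    by (rule eq_matI) (simp_all add: row)
  then have "minor_fun s A = (\<Sum>f\<in>?F. det (mat\<^sub>r s s (\<lambda>i. ?a i (f i))))"
    unfolding minor_fun_det by (simp only:) (rule det_linear_rows_sum, auto)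
  also have "\<dots> \<in> ipow W I (card S - r)"
  proof (rule ipow_sum)
    fix f assume f: "f \<in> ?F"
    have "det (mat\<^sub>r s s (\<lambda>i. ?a i (f i))) = (\<Prod>i = 0..<s. ?Y i (f i)) * det (mat\<^sub>r s s (\<lambda>i. vec s (?Z i (f i))))"
      by (rule det_rows_mul) auto
    also have "\<dots> \<in> ipow W I (card S - r)"
    proof (rule ipow_scale, cases "inj_on f {i\<in>S. f i \<noteq> r}")
      case False
      then obtain i i' where i: "i \<in> S" "i' \<in> S" "f i \<noteq> r" "f i' = f i" "i \<noteq> i'"
        unfolding inj_on_def by auto
      then have "i < s" "i' < s" using S by auto
      then have "det (mat\<^sub>r s s (\<lambda>i. vec s (?Z i (f i)))) = 0"
        using i by (intro det_identical_rows[of _ s i i']) auto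
      then show "det (mat\<^sub>r s s (\<lambda>i. vec s (?Z i (f i)))) \<in> ipow W I (card S - r)"
        by (simp add: ipow_0_mem)
    next
      case True
      have finS: "finite S" using S finite_subset by blast
      have "f ` {i\<in>S. f i \<noteq> r} \<subseteq> {..<r}"
      proof (rule image_subsetI)
        fix i assume "i \<in> {i\<in>S. f i \<noteq> r}"
        moreover from this have "f i < Suc r" using f S by auto
        ultimately show "f i \<in> {..<r}" by auto
      qed
      then have "card {i\<in>S. f i \<noteq> r} \<le> r"
        using card_inj_on_le[OF True, of "{..<r}"] by simp
      moreover have "card S = card {i\<in>S. f i \<noteq> r} + card {i\<in>S. f i = r}"
        using finS by (subst card_Un_disjoint[symmetric]) (auto intro: arg_cong[of _ _ card])
      ultimately have card: "card S - r \<le> card {i\<in>S. f i = r}" by simp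
      have "card {i\<in>S. f i = r} = (\<Sum>i\<in>{i\<in>S. f i = r}. 1)" by simp
      also have "\<dots> = (\<Sum>i\<in>{0..<s}. if i \<in> S \<and> f i = r then 1 else 0)"
        by (rule sum.mono_neutral_cong_left) (use S in auto)
      finally have count: "(\<Sum>i\<in>{0..<s}. if i \<in> S \<and> f i = r then 1 else 0) = card {i\<in>S. f i = r}" by simp
      \<comment> \<open>Each Leibniz term contains an entry of \<open>E\<close> for every
        \<open>i\<close> in \<open>S\<close> with \<open>f i = r\<close>.\<close>
      have "det (mat\<^sub>r s s (\<lambda>i. vec s (?Z i (f i)))) =
          (\<Sum>\<pi> | \<pi> permutes {0..<s}. signof \<pi> * (\<Prod>i = 0..<s. mat\<^sub>r s s (\<lambda>i. vec s (?Z i (f i))) $$ (i, \<pi> i)))"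
        by (rule det_def') simp
      also have "\<dots> \<in> ipow W I (card {i\<in>S. f i = r})"
      proof (intro ipow_sum ipow_scale)
        fix \<pi> assume "\<pi> \<in> {\<pi>. \<pi> permutes {0..<s}}"
        then have \<pi>: "\<pi> i < s" if "i < s" for i using that permutes_in_image[of \<pi> "{0..<s}" i] by auto
        show "(\<Prod>i = 0..<s. mat\<^sub>r s s (\<lambda>i. vec s (?Z i (f i))) $$ (i, \<pi> i)) \<in> ipow W I (card {i\<in>S. f i = r})"
          unfolding count[symmetric]
          by (rule ipow_prod) (use \<pi> E in \<open>auto simp: ipow_zero\<close>)
      qed
      finally show "det (mat\<^sub>r s s (\<lambda>i. vec s (?Z i (f i)))) \<in> ipow W I (card S - r)"
        using card by (rule ipow_mono)
    qed
    finally show "det (mat\<^sub>r s s (\<lambda>i. ?a i (f i))) \<in> ipow W I (card S - r)" .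
  qed
  finally show ?thesis .
qed

text \<open>\<open>bordered r (i, j)\<close> is the \<open>(r + 1)\<close>-minor that adds row \<open>i\<close> and column \<open>j\<close> to the top left \<open>r\<close>-minor.
  After inverting \<open>corner_minor r\<close>, the ideal of \<open>(r + 1)\<close>-minors is a complete intersection generated by these
  with \<open>i, j \<ge> r\<close>.\<close>

definition corner_mat :: "nat \<Rightarrow> 'k::comm_ring_1 mpoly mat" where
  "corner_mat r = mat r r (\<lambda>(i, j). Var i j)"

definition corner_minor :: "nat \<Rightarrow> 'k::comm_ring_1 mpoly" where
  "corner_minor r = det (corner_mat r)"

text \<open>Cramer's rule with cleared denominators: divided by \<open>corner_minor r\<close>, these
  coefficients express the first \<open>r\<close> entries of column \<open>j\<close> by the first
  \<open>r\<close> columns.\<close>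

definition corner_proj :: "nat \<Rightarrow> nat \<Rightarrow> nat \<Rightarrow> 'k::comm_ring_1 mpoly" where
  "corner_proj r k j = (\<Sum>l<r. adj_mat (corner_mat r) $$ (k, l) * Var l j)"

definition bordered :: "nat \<Rightarrow> nat \<times> nat \<Rightarrow> 'k::comm_ring_1 mpoly" where
  "bordered r = (\<lambda>(i, j). corner_minor r * Var i j - (\<Sum>k<r. Var i k * corner_proj r k j))"

lemma corner_adj:
  fixes r :: nat
  defines "B \<equiv> adj_mat (corner_mat r) :: 'k::comm_ring_1 mpoly mat"
  assumes i: "i < r" and l: "l < r"
  shows "(\<Sum>k<r. Var i k * B $$ (k, l)) = (if i = l then corner_minor r else 0)"
    and "(\<Sum>k<r. B $$ (i, k) * Var k l) = (if i = l then corner_minor r else 0)"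
proof -
  have U: "(corner_mat r :: 'k mpoly mat) \<in> carrier_mat r r" by (simp add: corner_mat_def)
  have B: "B \<in> carrier_mat r r" unfolding B_def by (rule adj_mat(1)[OF U])
  have "(corner_mat r * B) $$ (i, l) = (if i = l then corner_minor r else 0)"
    unfolding B_def adj_mat(2)[OF U] using i l by (simp add: corner_minor_def)
  moreover have "(corner_mat r * B) $$ (i, l) = (\<Sum>k<r. Var i k * B $$ (k, l))"
    using i l B by (simp add: scalar_prod_def corner_mat_def atLeast0LessThan)
  ultimately show "(\<Sum>k<r. Var i k * B $$ (k, l)) = (if i = l then corner_minor r else 0)" by simp
  have "(B * corner_mat r) $$ (i, l) = (if i = l then corner_minor r else 0)"
    unfolding B_def adj_mat(3)[OF U] using i l by (simp add: corner_minor_def)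
  moreover have "(B * corner_mat r) $$ (i, l) = (\<Sum>k<r. B $$ (i, k) * Var k l)"
    using i l B by (simp add: scalar_prod_def corner_mat_def atLeast0LessThan)
  ultimately show "(\<Sum>k<r. B $$ (i, k) * Var k l) = (if i = l then corner_minor r else 0)" by simp
qed

lemma bordered_top:
  assumes i: "i < r"
  shows "bordered r (i, j) = (0 :: 'k::comm_ring_1 mpoly)"
proof -
  let ?B = "adj_mat (corner_mat r) :: 'k mpoly mat"
  have "(\<Sum>k<r. Var i k * corner_proj r k j) = (\<Sum>l<r. (\<Sum>k<r. Var i k * ?B $$ (k, l)) * Var l j)"
    unfolding corner_proj_def sum_distrib_left sum_distrib_right
    by (subst sum.swap) (simp add: mult.assoc)
  also have "\<dots> = (\<Sum>l<r. if i = l then corner_minor r * Var l j else 0)"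
    by (rule sum.cong) (use i in \<open>auto simp: corner_adj\<close>)
  finally show ?thesis using i by (simp add: bordered_def)
qed

lemma bordered_left:
  assumes j: "j < r"
  shows "bordered r (i, j) = (0 :: 'k::comm_ring_1 mpoly)"
proof -
  have "corner_proj r k j = (if k = j then corner_minor r else 0 :: 'k mpoly)" if "k < r" for k
    unfolding corner_proj_def using corner_adj(2)[OF that j] .
  then have "(\<Sum>k<r. Var i k * corner_proj r k j) =
      (\<Sum>k<r. if k = j then Var i k * corner_minor r else 0 :: 'k mpoly)"
    by (intro sum.cong) auto
  then show ?thesis using j by (simp add: bordered_def mult.commute)
qed

abbreviation border :: "nat \<Rightarrow> nat \<Rightarrow> nat \<Rightarrow> (nat \<times> nat) set" where
  "border r a n \<equiv> {r..<a} \<times> {r..<n}"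

lemma bordered_ipow:
  assumes "i < a" "j < n"
  shows "bordered r (i, j) \<in> ipow (bordered r) (border r a n) 1"
proof (cases "i < r \<or> j < r")
  case True
  then show ?thesis by (auto simp: bordered_top bordered_left ipow_0_mem)
next
  case False
  then show ?thesis using assms by (intro ipow_one) auto
qed

text \<open>Scaled by \<open>corner_minor r\<close>, each row becomes a combination of the
  \<open>r\<close> rows \<open>corner_proj r k\<close> plus a row of \<open>bordered\<close>
  entries; for rows below index \<open>a\<close> these entries lie in the ideal.\<close>

lemma minor_ipow:
  assumes C: "\<And>j. j < s \<Longrightarrow> C j < n"
  shows "corner_minor r ^ s * minor s R C \<in> ipow (bordered r) (border r a n) (card {i. i < s \<and> R i < a} - r)"
proof -
  let ?S = "{i. i < s \<and> R i < a}"
  let ?A = "\<lambda>i j. corner_minor r * Var (R i) (C j)"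
  have "corner_minor r ^ s * minor s R C = minor_fun s ?A"
    unfolding minor_eq_minor_fun minor_fun_def
    by (simp add: prod.distrib sum_distrib_left mult_ac)
  also have "\<dots> \<in> ipow (bordered r) (border r a n) (card ?S - r)"
  proof (rule minor_fun_ipow[where Y = "\<lambda>i k. Var (R i) k" and Z = "\<lambda>k j. corner_proj r k (C j)"
        and E = "\<lambda>i j. bordered r (R i, C j)"])
    fix i j assume "i \<in> ?S" "j < s"
    then show "bordered r (R i, C j) \<in> ipow (bordered r) (border r a n) 1"
      using C by (intro bordered_ipow) auto
  qed (auto simp: bordered_def)
  finally show ?thesis .
qed

section \<open>Vanishing orders after inverting the corner minor\<close>

text \<open>A power of \<open>corner_minor r\<close> is allowed because only the localized ideal is
  a complete intersection; this plays the part of a symbolic power.\<close>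

definition vanishes_to :: "nat \<Rightarrow> nat \<Rightarrow> nat \<Rightarrow> 'k::comm_ring_1 mpoly \<Rightarrow> nat \<Rightarrow> bool" where
  "vanishes_to r a n f e \<longleftrightarrow> (\<exists>N. corner_minor r ^ N * f \<in> ipow (bordered r) (border r a n) e)"

lemma vanishes_to_mult:
  assumes "vanishes_to r a n f e" "vanishes_to r a n g e'"
  shows "vanishes_to r a n (f * g) (e + e')"
proof -
  obtain N N' where "corner_minor r ^ N * f \<in> ipow (bordered r) (border r a n) e"
    "corner_minor r ^ N' * g \<in> ipow (bordered r) (border r a n) e'"
    using assms unfolding vanishes_to_def by blast
  then have "(corner_minor r ^ N * f) * (corner_minor r ^ N' * g) \<in> ipow (bordered r) (border r a n) (e + e')"
    by (rule ipow_mult)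
  then show ?thesis unfolding vanishes_to_def
    by (intro exI[of _ "N + N'"]) (simp add: power_add mult_ac)
qed

lemma vanishes_to_zero: "vanishes_to r a n f 0"
  unfolding vanishes_to_def using ipow_zero by blast

lemma vanishes_to_mono: "vanishes_to r a n f e \<Longrightarrow> e' \<le> e \<Longrightarrow> vanishes_to r a n f e'"
  unfolding vanishes_to_def using ipow_mono by blast

lemma vanishes_to_prod:
  "(\<And>i. i \<in> A \<Longrightarrow> vanishes_to r a n (f i) (e i)) \<Longrightarrow> vanishes_to r a n (prod f A) (sum e A)"
proof (induction A rule: infinite_finite_induct)
  case (insert x A)
  then show ?case by (simp add: vanishes_to_mult)
qed (simp_all add: vanishes_to_zero)

lemma vanishes_to_add:
  assumes "vanishes_to r a n f e" "vanishes_to r a n g e"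
  shows "vanishes_to r a n (f + g) e"
proof -
  obtain N N' where N: "corner_minor r ^ N * f \<in> ipow (bordered r) (border r a n) e"
    "corner_minor r ^ N' * g \<in> ipow (bordered r) (border r a n) e"
    using assms unfolding vanishes_to_def by blast
  have "corner_minor r ^ (N + N') * (f + g) =
      corner_minor r ^ N' * (corner_minor r ^ N * f) + corner_minor r ^ N * (corner_minor r ^ N' * g)"
    by (simp add: power_add algebra_simps)
  also have "\<dots> \<in> ipow (bordered r) (border r a n) e" by (intro ipow_add ipow_scale N)
  finally show ?thesis unfolding vanishes_to_def by blast
qed

lemma vanishes_to_minor:
  assumes "\<And>j. j < s \<Longrightarrow> C j < n" "e + r \<le> card {i. i < s \<and> R i < a}"
  shows "vanishes_to r a n (minor s R C) e"
proof -
  have "vanishes_to r a n (minor s R C) (card {i. i < s \<and> R i < a} - r)"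
    unfolding vanishes_to_def using minor_ipow[of s C n r R a, OF assms(1)] by blast
  then show ?thesis by (rule vanishes_to_mono) (use assms(2) in simp)
qed

lemma vanishes_to_detIdeal:
  assumes "f \<in> detIdeal m n (Suc r) a"
  shows "vanishes_to r a n f 1"
  using assms unfolding detIdeal_def ideal_genS_eq_idl
proof (induction rule: idl_induct)
  case zero
  show ?case unfolding vanishes_to_def by (simp add: ipow_0_mem)
next
  case (gen c g)
  then obtain R C where g: "g = minor (Suc r) R C" "\<forall>i<Suc r. R i < a \<and> C i < n"
    unfolding minors_def by blast
  have "{i. i < Suc r \<and> R i < a} = {..<Suc r}" using g(2) by auto
  then have "vanishes_to r a n g 1"
    unfolding g(1) using g(2) by (intro vanishes_to_minor) auto
  with vanishes_to_zero[of r a n c] have "vanishes_to r a n (c * g) (0 + 1)"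
    by (rule vanishes_to_mult)
  then show ?case by simp
qed (rule vanishes_to_add)

text \<open>Truncated subtraction makes the indices up to \<open>r\<close> contribute 0, leaving a
  triangular number.\<close>

lemma sum_diff_const: "2 * (\<Sum>i\<in>{1..<r + Suc q}. i - r) = q * Suc q"
proof (induction q)
  case 0
  have "(\<Sum>i\<in>{1..<r + Suc 0}. i - r) = 0" by (rule sum.neutral) auto
  then show ?case by simp
next
  case (Suc q)
  have "{1..<r + Suc (Suc q)} = insert (r + Suc q) {1..<r + Suc q}" by auto
  then show ?case using Suc by (simp add: algebra_simps)
qed

text \<open>An \<open>i\<close>-minor has order at least \<open>i - r\<close>. With
  \<open>q = \<mu> - r - 1\<close>, alphas and betas together give \<open>q * (q + 1)\<close> and
  the \<open>d + 1\<close> deltas give \<open>q + 1\<close> each, in total the codimension.\<close>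

lemma vanishes_to_Delta_full:
  assumes r: "r < min m n"
  shows "vanishes_to r m n (Delta m n) ((m - r) * (n - r))"
proof -
  define \<mu> where "\<mu> = min m n"
  define d where "d = max m n - \<mu>"
  define q where "q = \<mu> - Suc r"
  have \<mu>: "\<mu> = r + Suc q" using r by (simp add: \<mu>_def q_def)
  have c: "card {i. i < s \<and> P i} = s" if "\<And>i. i < s \<Longrightarrow> P i" for s P
  proof -
    have "{i. i < s \<and> P i} = {..<s}" using that by auto
    then show ?thesis by simp
  qed
  have a: "vanishes_to r m n (alpha m i) (i - r)" if "i \<in> {1..<\<mu>}" for i
  proof (cases "r \<le> i")
    case True
    then show ?thesis unfolding alpha_def
      by (intro vanishes_to_minor) (use that in \<open>auto simp: \<mu>_def c\<close>)
  qed (simp add: vanishes_to_zero)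
  have b: "vanishes_to r m n (beta n i) (i - r)" if "i \<in> {1..<\<mu>}" for i
  proof (cases "r \<le> i")
    case True
    then show ?thesis unfolding beta_def
      by (intro vanishes_to_minor) (use that in \<open>auto simp: \<mu>_def c\<close>)
  qed (simp add: vanishes_to_zero)
  have dl: "vanishes_to r m n (delta m n j) (Suc q)" if "j \<in> {0..d}" for j
    unfolding delta_def using that \<mu>
    by (auto simp: \<mu>_def d_def c intro!: vanishes_to_minor)
  have "vanishes_to r m n (Delta m n)
      ((\<Sum>i\<in>{1..<\<mu>}. i - r) + (\<Sum>j\<in>{0..d}. Suc q) + (\<Sum>i\<in>{1..<\<mu>}. i - r))"
    unfolding Delta_def Let_def \<mu>_def[symmetric] d_def[symmetric]
    by (intro vanishes_to_mult vanishes_to_prod a b dl)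
  also have "(\<Sum>i\<in>{1..<\<mu>}. i - r) + (\<Sum>j\<in>{0..d}. Suc q) + (\<Sum>i\<in>{1..<\<mu>}. i - r) = Suc q * (Suc q + d)"
    using sum_diff_const[of r q] unfolding \<mu> by (simp add: algebra_simps)
  also have "\<dots> = (m - r) * (n - r)"
  proof (cases "m \<le> n")
    case True
    then have "m - r = Suc q" "n - r = Suc q + d" using \<mu> by (simp_all add: \<mu>_def d_def)
    then show ?thesis by simp
  next
    case False
    then have "n - r = Suc q" "m - r = Suc q + d" using \<mu> by (simp_all add: \<mu>_def d_def)
    then show ?thesis by (simp add: mult.commute)
  qed
  finally show ?thesis .
qed

text \<open>Every minor involving all of the first \<open>Suc r\<close> rows has order at least 1.
  The betas of size above \<open>r\<close> and the deltas starting at row 0 supply the required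
  \<open>n - r\<close>.\<close>

lemma vanishes_to_Delta_rows:
  assumes r: "Suc r < min m n"
  shows "vanishes_to r (Suc r) n (Delta m n) (n - r)"
proof -
  define \<mu> where "\<mu> = min m n"
  define d where "d = max m n - \<mu>"
  have c: "card {i. i < s \<and> i < Suc r} = Suc r" if "Suc r \<le> s" for s
  proof -
    have "{i. i < s \<and> i < Suc r} = {..<Suc r}" using that by auto
    then show ?thesis by simp
  qed
  have b: "vanishes_to r (Suc r) n (beta n i) (if Suc r \<le> i then 1 else 0)" if "i \<in> {1..<\<mu>}" for i
    unfolding beta_def using that
    by (auto simp: \<mu>_def c vanishes_to_zero intro!: vanishes_to_minor)
  have dl: "vanishes_to r (Suc r) n (delta m n j) (if m \<le> n \<or> j = 0 then 1 else 0)" if "j \<in> {0..d}" for j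
    unfolding delta_def using that r
    by (auto simp: \<mu>_def d_def c vanishes_to_zero intro!: vanishes_to_minor)
  have "vanishes_to r (Suc r) n (Delta m n)
      ((\<Sum>i\<in>{1..<\<mu>}. 0) + (\<Sum>j\<in>{0..d}. if m \<le> n \<or> j = 0 then 1 else 0) +
       (\<Sum>i\<in>{1..<\<mu>}. if Suc r \<le> i then 1 else 0))"
    unfolding Delta_def Let_def \<mu>_def[symmetric] d_def[symmetric]
    by (intro vanishes_to_mult vanishes_to_prod b dl vanishes_to_zero)
  moreover have "(\<Sum>i\<in>{1..<\<mu>}. if Suc r \<le> i then 1 else 0) = \<mu> - Suc r"
  proof -
    have "(\<Sum>i\<in>{1..<\<mu>}. if Suc r \<le> i then 1 else 0) = (\<Sum>i\<in>{Suc r..<\<mu>}. 1::nat)"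
      by (rule sum.mono_neutral_cong_right) auto
    then show ?thesis by simp
  qed
  moreover have "(\<Sum>j\<in>{0..d}. if m \<le> n \<or> j = 0 then 1 else 0) = (if m \<le> n then Suc d else 1)"
    by simp
  ultimately show ?thesis using r by (auto simp: \<mu>_def d_def split: if_splits)
qed

lemma corner_minor_eq: "corner_minor r = minor r (\<lambda>k. k) (\<lambda>k. k)"
  by (simp add: corner_minor_def corner_mat_def minor_eq_minor_fun minor_fun_det)

section \<open>Generic matrices of bounded rank\<close>

text \<open>Adding the parameter along the diagonal gives the characteristic polynomial of the
  negated matrix, which is monic.\<close>

lemma char_shift_det_nonzero:
  fixes Y :: "nat \<Rightarrow> nat \<Rightarrow> 'l::field"
  shows "det (mat r r (\<lambda>(i, k). [:Y i k, if i = k then 1 else 0:])) \<noteq> 0"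
proof -
  let ?M = "mat r r (\<lambda>(i, k). - Y i k)"
  have "mat r r (\<lambda>(i, k). [:Y i k, if i = k then 1 else 0:]) = char_poly_matrix ?M"
    unfolding char_poly_matrix_def by (rule eq_matI) auto
  then have "det (mat r r (\<lambda>(i, k). [:Y i k, if i = k then 1 else 0:])) = char_poly ?M"
    by (simp add: char_poly_def)
  moreover have "coeff (char_poly ?M) r = 1"
    using degree_monic_char_poly[of ?M r] by simp
  ultimately show ?thesis by auto
qed

context point_eval
begin

lemma ev_corner_minor: "ev q (corner_minor r) = minor_fun r (\<lambda>i j. q (i, j))"
  by (simp add: corner_minor_eq mev_minor)

text \<open>When the corner minor is nonzero, row \<open>i\<close> is a combination of the first
  \<open>r\<close> rows. The bordered minor is linear in its added row and vanishes for those
  rows.\<close>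

lemma ev_bordered:
  assumes rk: "rk_le r a n q" and u: "ev q (corner_minor r) \<noteq> 0"
    and r: "r \<le> a" "r \<le> n" and ij: "i < a" "j < n"
  shows "ev q (bordered r (i, j)) = 0"
proof -
  obtain Y Z where YZ: "\<And>i j. i < a \<Longrightarrow> j < n \<Longrightarrow> q (i, j) = (\<Sum>k<r. Y i k * Z k j)"
    using rk unfolding rk_le_def by blast
  have ev_b: "ev q (bordered r (i, j)) =
      ev q (corner_minor r) * q (i, j) - (\<Sum>k<r. q (i, k) * ev q (corner_proj r k j))" for i
    by (simp add: bordered_def ev.hom_minus ev.hom_sum ev.hom_mult mev_Var)
  have "\<not> (\<exists>\<nu>. (\<exists>k<r. \<nu> k \<noteq> 0) \<and> (\<forall>l<r. (\<Sum>k<r. \<nu> k * Y l k) = 0))"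
  proof
    assume "\<exists>\<nu>. (\<exists>k<r. \<nu> k \<noteq> 0) \<and> (\<forall>l<r. (\<Sum>k<r. \<nu> k * Y l k) = 0)"
    then obtain \<nu> k0 where \<nu>: "k0 < r" "\<nu> k0 \<noteq> 0" "\<forall>l<r. (\<Sum>k<r. \<nu> k * Y l k) = 0" by blast
    \<comment> \<open>The matrix is transposed because \<open>rk_le_dependent\<close> eliminates
      from the right factor, while the relation here concerns \<open>Y\<close>.\<close>
    have "rk_le (r - 1) r r (\<lambda>(j, i). q (i, j))"
      by (rule rk_le_dependent[where Y = "\<lambda>j k. Z k j" and Z = "\<lambda>k l. Y l k" and \<nu> = \<nu> and ?k0.0 = k0])
        (use YZ r \<nu> in \<open>auto simp: mult.commute\<close>)
    then obtain Y' Z' where "\<forall>j<r. \<forall>i<r. q (i, j) = (\<Sum>k<r - 1. Y' j k * Z' k i)"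
      unfolding rk_le_def by auto
    then have "minor_fun (Suc (r - 1)) (\<lambda>i j. q (i, j)) = 0" using \<nu>(1)
      by (intro minor_fun_rank_zero[where Y = "\<lambda>i k. Z' k i" and Z = "\<lambda>k j. Y' j k"])
        (auto simp: mult.commute)
    then show False using u \<nu>(1) by (simp add: ev_corner_minor)
  qed
  then have "\<forall>\<zeta>. \<exists>c. \<forall>k<r. \<zeta> k = (\<Sum>l<r. Y l k * c l)"
    using rows_dependent_or_onto[of r r "\<lambda>k l. Y l k"] by blast
  from spec[OF this, of "Y i"] obtain c where c: "\<forall>k<r. Y i k = (\<Sum>l<r. Y l k * c l)" ..
  have row: "q (i, j) = (\<Sum>l<r. c l * q (l, j))" if "j < n" for j
  proof -
    have "q (i, j) = (\<Sum>k<r. (\<Sum>l<r. Y l k * c l) * Z k j)" using YZ ij that c by simp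
    also have "\<dots> = (\<Sum>l<r. c l * (\<Sum>k<r. Y l k * Z k j))"
      unfolding sum_distrib_left sum_distrib_right by (subst sum.swap) (simp add: mult_ac)
    finally show ?thesis using YZ r that by simp
  qed
  have "ev q (bordered r (i, j)) = (\<Sum>l<r. c l * ev q (bordered r (l, j)))"
  proof -
    have "(\<Sum>k<r. q (i, k) * ev q (corner_proj r k j)) =
        (\<Sum>k<r. (\<Sum>l<r. c l * q (l, k)) * ev q (corner_proj r k j))"
      using row r by (intro sum.cong) auto
    also have "\<dots> = (\<Sum>l<r. c l * (\<Sum>k<r. q (l, k) * ev q (corner_proj r k j)))"
      unfolding sum_distrib_left sum_distrib_right by (subst sum.swap) (simp add: mult_ac)
    finally show ?thesis
      unfolding ev_b row[OF ij(2)] by (simp add: right_diff_distrib sum_subtractf sum_distrib_left mult_ac)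
  qed
  also have "\<dots> = 0" by (rule sum.neutral) (simp add: bordered_top)
  finally show ?thesis .
qed

text \<open>Adding the parameter on the diagonals of both factors keeps the rank bound and makes the
  corner minor a nonzero polynomial. So \<open>g\<close> vanishes at almost all members of the
  family, hence at parameter 0, which is \<open>q\<close>.\<close>

lemma vanishes_of_generic:
  assumes r: "r \<le> a" "r \<le> n" and rk: "rk_le r a n q"
    and generic: "\<And>q. rk_le r a n q \<Longrightarrow> ev q (corner_minor r) \<noteq> 0 \<Longrightarrow> ev q g = 0"
  shows "ev q g = 0"
proof -
  interpret c: comm_ring_hom "\<lambda>c. [:emb c:]" by (rule const_hom)
  obtain Y Z where YZ: "\<And>i j. i < a \<Longrightarrow> j < n \<Longrightarrow> q (i, j) = (\<Sum>k<r. Y i k * Z k j)"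
    using rk unfolding rk_le_def by blast
  define Y' where "Y' i k = [:Y i k, if i = k then 1 else 0:]" for i k
  define Z' where "Z' k j = [:Z k j, if k = j then 1 else 0:]" for k j
  define Q where "Q = (\<lambda>(i, j). if i < a \<and> j < n then \<Sum>k<r. Y' i k * Z' k j else [:q (i, j):])"
  define u where "u = mev (\<lambda>c. [:emb c:]) Q (corner_minor r)"
  have "u = det (mat r r (\<lambda>(i, j). Q (i, j)))"
    by (simp add: u_def corner_minor_eq c.mev_minor minor_fun_det)
  also have "mat r r (\<lambda>(i, j). Q (i, j)) = mat r r (\<lambda>(i, k). Y' i k) * mat r r (\<lambda>(k, j). Z' k j)"
    by (rule eq_matI) (use r in \<open>auto simp: Q_def scalar_prod_def atLeast0LessThan\<close>)
  also have "det \<dots> = det (mat r r (\<lambda>(i, k). Y' i k)) * det (mat r r (\<lambda>(k, j). Z' k j))"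
    by (rule det_mult) auto
  also have "\<dots> \<noteq> 0" unfolding Y'_def Z'_def by (intro no_zero_divisors char_shift_det_nonzero)
  finally have u: "u \<noteq> 0" .
  have "mev (\<lambda>c. [:emb c:]) Q g = 0"
  proof (rule poly_zero_of_cofinite)
    show "finite {x. poly u x = 0}" using u by (rule poly_roots_finite)
    fix x assume "x \<notin> {x. poly u x = 0}"
    then have "ev (\<lambda>v. poly (Q v) x) (corner_minor r) \<noteq> 0" by (simp add: u_def poly_mev)
    moreover have "rk_le r a n (\<lambda>v. poly (Q v) x)"
      by (rule rk_leI[where Y = "\<lambda>i k. poly (Y' i k) x" and Z = "\<lambda>k j. poly (Z' k j) x"])
        (simp add: Q_def poly_sum)
    ultimately show "poly (mev (\<lambda>c. [:emb c:]) Q g) x = 0" by (simp add: poly_mev generic)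
  qed
  moreover have "(\<lambda>v. poly (Q v) 0) = q"
  proof
    fix v show "poly (Q v) 0 = q v"
      by (cases v) (simp add: Q_def poly_sum Y'_def Z'_def YZ mult.commute)
  qed
  ultimately show ?thesis using poly_mev[of Q g 0] by simp
qed

end

section \<open>Compatibility of determinantal ideals\<close>

text \<open>A perfect field may be finite; its rational function field is always infinite.\<close>

lemma point_eval_fract: "point_eval (\<lambda>c::'k::field. to_fract [:c:])"
proof
  have "inj (\<lambda>i. to_fract (monom (1::'k) i))"
    by (rule injI) (metis to_fract_eq_iff monom_eq_iff' zero_neq_one)
  then show "infinite (UNIV :: 'k poly fract set)"
    using infinite_UNIV_nat finite_imageD rev_finite_subset by (metis subset_UNIV)
qed (simp_all flip: to_fract_add to_fract_mult one_pCons)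

lemma Delta_polyS: "Delta m n \<in> polyS m n"
  unfolding polyS_eq_polyV Delta_def Let_def
  by (intro polyV_mult polyV_prod)
    (auto simp: alpha_def beta_def delta_def grid_def intro!: minor_polyV)

context perfect_char
begin

text \<open>By pigeonhole some \<open>W v\<close> occurs with exponent at least \<open>p\<close>;
  its \<open>p\<close>-th power leaves the trace as the factor \<open>W v\<close>, which vanishes at
  \<open>q\<close>.\<close>

lemma ev_frob_trace_ipow:
  fixes W :: "'v \<Rightarrow> 'k mpoly" and emb :: "'k \<Rightarrow> 'l::field"
  assumes hom: "comm_ring_hom emb" and W: "\<And>v. v \<in> I \<Longrightarrow> mev emb q (W v) = 0"
    and f: "f \<in> ipow W I (card I * (p - 1) + 1)"
  shows "mev emb q (frob_trace p m n f) = 0"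
proof -
  interpret comm_ring_hom emb by fact
  show ?thesis using f[unfolded ipow_def]
  proof (induction rule: idl_induct)
    case (gen c g)
    then obtain k where g: "g = (\<Prod>v\<in>I. W v ^ k v)" and k: "card I * (p - 1) + 1 \<le> sum k I" by blast
    have "\<exists>v\<in>I. p \<le> k v"
    proof (rule ccontr)
      assume "\<not> (\<exists>v\<in>I. p \<le> k v)"
      then have "sum k I \<le> (\<Sum>v\<in>I. p - 1)" by (intro sum_mono) force
      then show False using k by simp
    qed
    then obtain v where v: "v \<in> I" "p \<le> k v" by blast
    have "finite I" using k by (cases "finite I") auto
    moreover have "W v ^ k v = W v ^ p * W v ^ (k v - p)"
      using v(2) by (simp flip: power_add)
    ultimately have "c * g = W v ^ p * (c * (W v ^ (k v - p) * (\<Prod>w\<in>I - {v}. W w ^ k w)))"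
      using v(1) by (simp add: g prod.remove[of I v] mult_ac)
    then have "frob_trace p m n (c * g) =
        W v * frob_trace p m n (c * (W v ^ (k v - p) * (\<Prod>w\<in>I - {v}. W w ^ k w)))"
      by (simp only: frob_trace_power_mult)
    then show ?case using W[OF v(1)] by (simp add: mev_mult)
  qed (simp_all add: frob_trace_0 frob_trace_add mev_add)
qed

text \<open>The order of \<open>Delta m n ^ (p - 1) * f\<close> exceeds the pigeonhole bound for
  \<open>card ?I\<close> generators, so the trace vanishes at generic points, then at all points of
  the locus, and therefore lies in the ideal.\<close>

lemma phi_detIdeal:
  assumes a: "a \<le> m" and r: "r \<le> a" "r \<le> n"
    and Delta: "vanishes_to r a n (Delta m n :: 'k mpoly) ((a - r) * (n - r))"
    and f: "f \<in> (detIdeal m n (Suc r) a :: 'k mpoly set)"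
  shows "phi p m n f \<in> detIdeal m n (Suc r) a"
proof -
  interpret point_eval "\<lambda>c::'k. to_fract [:c:]" by (rule point_eval_fract)
  let ?I = "border r a n"
  let ?D = "Delta m n :: 'k mpoly"
  have "vanishes_to r a n (\<Prod>_<p - 1. ?D) (\<Sum>_<p - 1. (a - r) * (n - r))"
    by (rule vanishes_to_prod) (rule Delta)
  then have "vanishes_to r a n (?D ^ (p - 1) * f) ((p - 1) * ((a - r) * (n - r)) + 1)"
    using vanishes_to_mult[OF _ vanishes_to_detIdeal[OF f]] by simp
  then obtain N where "corner_minor r ^ N * (?D ^ (p - 1) * f)
      \<in> ipow (bordered r) ?I ((p - 1) * ((a - r) * (n - r)) + 1)"
    unfolding vanishes_to_def by blast
  \<comment> \<open>The extra factor raises the exponent of \<open>corner_minor r\<close> to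
    \<open>N * p\<close>, so the trace releases \<open>corner_minor r ^ N\<close>, which is nonzero
    at generic points.\<close>
  then have "corner_minor r ^ (N * (p - 1)) * (corner_minor r ^ N * (?D ^ (p - 1) * f))
      \<in> ipow (bordered r) ?I ((p - 1) * ((a - r) * (n - r)) + 1)"
    by (rule ipow_scale)
  moreover have "corner_minor r ^ (N * (p - 1)) * (corner_minor r ^ N * (?D ^ (p - 1) * f)) =
      (corner_minor r ^ N) ^ p * (?D ^ (p - 1) * f)"
  proof -
    have "p = Suc (p - 1)" using prime_p prime_gt_0_nat by fastforce
    then have "N * p = N * (p - 1) + N" by (metis mult_Suc_right add.commute)
    then show ?thesis by (simp add: power_add mult.assoc flip: power_mult)
  qed
  ultimately have mem: "(corner_minor r ^ N) ^ p * (?D ^ (p - 1) * f) \<in> ipow (bordered r) ?I (card ?I * (p - 1) + 1)"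
    by (simp add: mult.commute)
  have "ev q (phi p m n f) = 0" if rk: "rk_le r a n q" and u: "ev q (corner_minor r) \<noteq> 0" for q
  proof -
    have "ev q (frob_trace p m n ((corner_minor r ^ N) ^ p * (?D ^ (p - 1) * f))) = 0"
      by (rule ev_frob_trace_ipow[OF comm_ring_hom_axioms _ mem])
        (use ev_bordered[OF rk u r] in auto)
    then show ?thesis using u
      by (simp add: frob_trace_power_mult phi_def ev.hom_mult ev.hom_power)
  qed
  then have "ev q (phi p m n f) = 0" if "rk_le r a n q" for q
    using vanishes_of_generic[OF r that] by blast
  moreover have "phi p m n f \<in> polyS m n"
  proof -
    have "minors (Suc r) a n \<subseteq> (polyV (grid m n) :: 'k mpoly set)"
      by (rule minors_polyV) (use a in \<open>auto simp: grid_def\<close>)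
    then have "f \<in> polyS m n"
      using f idl_polyV unfolding detIdeal_def ideal_genS_eq_idl polyS_eq_polyV by blast
    then show ?thesis
      using Delta_polyS unfolding phi_def polyS_eq_polyV
      by (intro frob_trace_polyV polyV_mult polyV_power)
  qed
  ultimately show ?thesis using a by (intro vanishing_detIdeal)
qed

end

theorem theorem4p3:
  fixes p m n :: nat
  assumes "prime p" and "CHAR('k::field) = p"
    and "surj (\<lambda>x::'k. x ^ p)"
  shows "phi p m n (1 :: 'k mpoly) = 1
    \<and> (\<forall>t. 2 \<le> t \<and> t \<le> min m n \<longrightarrow>
          (\<forall>f \<in> detIdeal m n t m. phi p m n f \<in> (detIdeal m n t m :: 'k mpoly set))
        \<and> (\<forall>f \<in> detIdeal m n (t - 1) (t - 1). phi p m n f \<in> (detIdeal m n (t - 1) (t - 1) :: 'k mpoly set)))"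
proof -
  interpret perfect_char p "TYPE('k)" by unfold_locales (fact assms)+
  show ?thesis
  proof (intro conjI allI impI ballI)
    show "phi p m n (1 :: 'k mpoly) = 1" by (rule phi_1)
  next
    fix t and f :: "'k mpoly"
    assume t: "2 \<le> t \<and> t \<le> min m n" and f: "f \<in> detIdeal m n t m"
    obtain r where "t = Suc r" "r < min m n" using t by (cases t) auto
    then show "phi p m n f \<in> detIdeal m n t m"
      using f by (auto intro!: phi_detIdeal vanishes_to_Delta_full)
  next
    fix t and f :: "'k mpoly"
    assume t: "2 \<le> t \<and> t \<le> min m n" and f: "f \<in> detIdeal m n (t - 1) (t - 1)"
    obtain r where r: "t = Suc (Suc r)" "Suc r < min m n"
      using t by (metis Suc_le_D Suc_le_mono le_eq_less_or_eq less_eq_Suc_le numeral_2_eq_2)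
    \<comment> \<open>With \<open>a = Suc r\<close> the border is a single row, so the codimension
      is \<open>n - r\<close>.\<close>
    have "vanishes_to r (Suc r) n (Delta m n :: 'k mpoly) ((Suc r - r) * (n - r))"
      using vanishes_to_Delta_rows[OF r(2)] by simp
    then show "phi p m n f \<in> detIdeal m n (t - 1) (t - 1)"
      using f r by (auto intro!: phi_detIdeal)
  qed
qed

end
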